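(* Let $\Delta_\nu(x,u^{(n)})=0$, $\nu=1,\dots,l$, be a system of linear (homogeneous) partial differential equations for $u=(u_1,\dots,u_l)$ with slowly increasing $\Delta_\nu$, and let $\eta\mapsto g_\eta$ be a slowly increasing symmetry group of this system. Assume that the operator defined by the left hand side, $u\mapsto(\Delta_\nu(\cdot,\mathrm{pr}^{(n)}u(\cdot)))_{\nu=1}^l$, is surjective as a map $(C^\infty(\Omega))^l\to(C^\infty(\Omega))^l$. Then $\eta\mapsto g_\eta$ is a symmetry group for the system in $\mathcal G(\Omega)$ as well.
   Context: $\Omega\subseteq\mathcal X=\mathbb R^p$ is open, $x\in\mathbb R^p$ are the independent variables, $u\in\mathcal U$ the dependent ones; $u^{(n)}$ collects $u$ and its partial derivatives up to order $n$ and $\mathrm{pr}^{(n)}u(x)$ is the collection of the values at $x$ of $u$ and its partial derivatives up to order $n$. The group acts as a smooth local one-parameter transformation group on an open subset of $\mathcal X\times\mathcal U$. $g_\eta u$ is the function whose graph is the image under $g_\eta$ of the graph of $u$. A (classical) symmetry group transforms smooth solutions into smooth solutions whenever the transformed function is defined. Colombeau algebra: $I=(0,1]$. $\mathcal E_M(\Omega)$ is the set of $(u_\varepsilon)_{\varepsilon\in I}\in C^\infty(\Omega)^I$ such that for all compact $K\subset\Omega$ and all multi-indices $\alpha$ there is $m\in\mathbb N$ with $\sup_{x\in K}|\partial^\alpha u_\varepsilon(x)|=O(\varepsilon^{-m})$ as $\varepsilon\to0$; $\mathcal N(\Omega)$ is the set of those for which, for all $K,\alpha$ and all $m\in\mathbb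 N$, $\sup_{x\in K}|\partial^\alpha u_\varepsilon(x)|=O(\varepsilon^{m})$. $\mathcal G(\Omega)=\mathcal E_M(\Omega)/\mathcal N(\Omega)$; classes are written $\mathrm{cl}[(u_\varepsilon)_{\varepsilon\in I}]$. A smooth function is slowly increasing (in $\mathcal O_M$) if each of its partial derivatives is bounded by a constant times some power of $(1+|\cdot|)$. A projectable transformation $g$, $g\cdot(x,u)=(\Xi_g(x),\Phi_g(x,u))$, is slowly increasing if $u\mapsto\Phi_g(x,u)$ is slowly increasing, uniformly for $x$ in compact sets (for each compact set of $x$ and each partial derivative there is $m$ such that the derivative of $\Phi_g$ is bounded by $C(1+|u|)^m$ for $x$ in that set); slowly increasing group actions are always understood to be projectable. For such $g$ and $U=\mathrm{cl}[(u_\varepsilon)_\varepsilon]\in\mathcal G(\Omega)^l$, $gU:=\mathrm{cl}[((\Phi_g\circ(\mathrm{id}\times u_\varepsilon))\circ\Xi_g^{-1})_{\varepsilon\in I}]\in\mathcal G(\Xi_g(\Omega))^l$. That $\eta\mapsto g_\eta$ is a symmetry group for the system in $\mathcal G(\Omega)$ means: whenever $U\in\mathcal G(\Omega)^l$ solves the system (with equality in $\mathcal G(\Omega)^l$) and $g_\eta U$ is defined, $g_\eta U$ solves the system in $\mathcal G(\Xi_\eta(\Omega))^l$, where $\Xi_\eta=\Xi_{g_\eta}$. *)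

theory Defs
  imports "HOL-Analysis.Analysis" "HOL-Library.Multiset"
begin

section \<open>Iterated partial derivatives and smooth functions\<close>

primrec iter_pd ::
  "'a::euclidean_space list \<Rightarrow> ('a \<Rightarrow> 'b::real_normed_vector) \<Rightarrow> 'a \<Rightarrow> 'b" where
  "iter_pd [] f = f"
| "iter_pd (b # bs) f = (\<lambda>x. frechet_derivative (iter_pd bs f) (at x) b)"

text \<open>
  Functions on an open set \<open>S\<close> are total functions whose values outside \<open>S\<close> are irrelevant.
  The lists over \<open>Basis\<close> enumerate all iterated partial derivatives; for smooth functions
  these are the \<open>\<partial>\<^sup>\<alpha>\<close>, each multi-index \<open>\<alpha>\<close> being represented by all orderings of its
  differentiations, which yield the same function on \<open>S\<close> by Schwarz's theorem.
\<close>

definition smooth_on ::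
  "'a::euclidean_space set \<Rightarrow> ('a \<Rightarrow> 'b::real_normed_vector) \<Rightarrow> bool" where
  "smooth_on S f \<longleftrightarrow> (\<forall>bs\<in>lists Basis. \<forall>x\<in>S. iter_pd bs f differentiable (at x))"

text \<open>
  The function \<open>u \<mapsto> F (x, u)\<close> is slowly increasing, uniformly for \<open>x\<close> in compact sets; \<open>W\<close> is
  the (open) domain of \<open>F\<close>, so that \<open>u\<close> ranges over the fibre of \<open>W\<close> over \<open>x\<close>.
\<close>

definition slowly_increasing ::
  "('a::euclidean_space \<times> 'b::euclidean_space) set
    \<Rightarrow> ('a \<times> 'b \<Rightarrow> 'c::real_normed_vector) \<Rightarrow> bool" where
  "slowly_increasing W F \<longleftrightarrow>
     smooth_on W F \<and>
     (\<forall>K. compact K \<longrightarrow> K \<subseteq> fst ` W \<longrightarrow>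
       (\<forall>bs\<in>lists Basis. \<exists>(m::nat) (C::real). \<forall>(x, u)\<in>W. x \<in> K \<longrightarrow>
          norm (iter_pd bs F (x, u)) \<le> C * (1 + norm u) ^ m))"


section \<open>Jets and differential operators\<close>

text \<open>
  The coordinates of the jet space of order \<open>n\<close> are the pairs \<open>(j, \<alpha>)\<close> of a component \<open>j\<close> of the
  dependent variable and a multi-index \<open>\<alpha>\<close> with \<open>\<bar>\<alpha>\<bar> \<le> n\<close>. Multi-indices are multisets of
  coordinate directions. To make the jet space a Euclidean space \<open>real ^ 'k\<close>, its coordinates are
  enumerated by a finite type \<open>'k\<close>; \<open>c\<close> is the enumeration and chooses, for each \<open>\<alpha>\<close>, one order
  in which to carry out the differentiations.
\<close>

definition jet_coords :: "nat \<Rightarrow> ('k::finite \<Rightarrow> 'l::finite \<times> 'p::finite list) \<Rightarrow> bool" where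
  "jet_coords n c \<longleftrightarrow>
     bij_betw (\<lambda>k. (fst (c k), mset (snd (c k)))) UNIV {(j, \<alpha>). size \<alpha> \<le> n}"

definition prolong ::
  "('k::finite \<Rightarrow> 'l::finite \<times> 'p::finite list) \<Rightarrow> (real^'p \<Rightarrow> real^'l) \<Rightarrow> real^'p \<Rightarrow> real^'k" where
  "prolong c u x = (\<chi> k. iter_pd (map (\<lambda>i. axis i 1) (snd (c k))) u x $ fst (c k))"

definition diff_op ::
  "('k::finite \<Rightarrow> 'l::finite \<times> 'p::finite list) \<Rightarrow> ((real^'p) \<times> (real^'k) \<Rightarrow> real^'l)
    \<Rightarrow> (real^'p \<Rightarrow> real^'l) \<Rightarrow> real^'p \<Rightarrow> real^'l" where
  "diff_op c \<Delta> u x = \<Delta> (x, prolong c u x)"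

definition smooth_solution ::
  "(real^'p) set \<Rightarrow> ('k::finite \<Rightarrow> 'l::finite \<times> 'p::finite list)
    \<Rightarrow> ((real^'p) \<times> (real^'k) \<Rightarrow> real^'l) \<Rightarrow> (real^'p \<Rightarrow> real^'l) \<Rightarrow> bool" where
  "smooth_solution \<Omega> c \<Delta> u \<longleftrightarrow> smooth_on \<Omega> u \<and> (\<forall>x\<in>\<Omega>. diff_op c \<Delta> u x = 0)"


section \<open>Local one-parameter transformation groups\<close>

text \<open>
  A smooth local action of \<open>(\<real>, +)\<close> on the open set \<open>M\<close>: \<open>g \<eta> z\<close> is defined for
  \<open>(\<eta>, z) \<in> V\<close>, and takes values in \<open>M\<close>.
\<close>

definition local_transformation_group ::
  "'a::euclidean_space set \<Rightarrow> (real \<times> 'a) set \<Rightarrow> (real \<Rightarrow> 'a \<Rightarrow> 'a) \<Rightarrow> bool" where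
  "local_transformation_group M V g \<longleftrightarrow>
     open M \<and> open V \<and> {0} \<times> M \<subseteq> V \<and> V \<subseteq> UNIV \<times> M \<and>
     smooth_on V (\<lambda>(\<eta>, z). g \<eta> z) \<and>
     (\<forall>(\<eta>, z)\<in>V. g \<eta> z \<in> M) \<and>
     (\<forall>z\<in>M. g 0 z = z) \<and>
     (\<forall>\<eta> \<theta> z. (\<eta>, z) \<in> V \<longrightarrow> (\<theta>, g \<eta> z) \<in> V \<longrightarrow> (\<theta> + \<eta>, z) \<in> V \<longrightarrow>
        g \<theta> (g \<eta> z) = g (\<theta> + \<eta>) z) \<and>
     (\<forall>(\<eta>, z)\<in>V. (- \<eta>, g \<eta> z) \<in> V \<and> g (- \<eta>) (g \<eta> z) = z)"

definition group_dom :: "(real \<times> 'a) set \<Rightarrow> real \<Rightarrow> 'a set" where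
  "group_dom V \<eta> = {z. (\<eta>, z) \<in> V}"

definition slowly_increasing_action ::
  "(real \<times> 'a::euclidean_space \<times> 'b::euclidean_space) set \<Rightarrow> (real \<Rightarrow> 'a \<times> 'b \<Rightarrow> 'a \<times> 'b)
    \<Rightarrow> (real \<Rightarrow> 'a \<Rightarrow> 'a) \<Rightarrow> (real \<Rightarrow> 'a \<times> 'b \<Rightarrow> 'b) \<Rightarrow> bool" where
  "slowly_increasing_action V g \<Xi> \<Phi> \<longleftrightarrow>
     (\<forall>\<eta>. (\<forall>(x, u)\<in>group_dom V \<eta>. g \<eta> (x, u) = (\<Xi> \<eta> x, \<Phi> \<eta> (x, u))) \<and>
          slowly_increasing (group_dom V \<eta>) (\<Phi> \<eta>))"

definition graph_over :: "'a set \<Rightarrow> ('a \<Rightarrow> 'b) \<Rightarrow> ('a \<times> 'b) set" where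
  "graph_over \<Omega> u = (\<lambda>x. (x, u x)) ` \<Omega>"

text \<open>
  The transformed function \<open>g\<^sub>\<eta> u\<close> is the function \<open>v\<close> on \<open>\<Omega>'\<close> whose graph is the image of the
  graph of \<open>u\<close>.
\<close>

definition classical_symmetry_group ::
  "(real^'p) set \<Rightarrow> ('k::finite \<Rightarrow> 'l::finite \<times> 'p::finite list)
    \<Rightarrow> ((real^'p) \<times> (real^'k) \<Rightarrow> real^'l) \<Rightarrow> (real \<times> (real^'p) \<times> (real^'l)) set
    \<Rightarrow> (real \<Rightarrow> (real^'p) \<times> (real^'l) \<Rightarrow> (real^'p) \<times> (real^'l)) \<Rightarrow> bool" where
  "classical_symmetry_group \<Omega> c \<Delta> V g \<longleftrightarrow>
     (\<forall>\<eta> u \<Omega>' v. smooth_solution \<Omega> c \<Delta> u \<longrightarrow> graph_over \<Omega> u \<subseteq> group_dom V \<eta> \<longrightarrow>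
        g \<eta> ` graph_over \<Omega> u = graph_over \<Omega>' v \<longrightarrow> smooth_solution \<Omega>' c \<Delta> v)"


section \<open>The Colombeau algebra\<close>

text \<open>
  Nets are indexed by \<open>real\<close>; only the indices in \<open>{0<..1}\<close> matter. Nets of \<open>\<real>\<^sup>l\<close>-valued
  functions are used directly, the estimates for the Euclidean norm being equivalent to the
  estimates for all components; thus \<open>colombeau \<Omega>\<close> at type \<open>real ^ 'l\<close> is the \<open>l\<close>-th power
  of the algebra over \<open>\<Omega>\<close>.
\<close>

definition moderate_nets ::
  "'a::euclidean_space set \<Rightarrow> (real \<Rightarrow> 'a \<Rightarrow> 'b::real_normed_vector) set" where
  "moderate_nets \<Omega> = {u. (\<forall>\<epsilon>\<in>{0<..1}. smooth_on \<Omega> (u \<epsilon>)) \<and>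
     (\<forall>K bs. compact K \<longrightarrow> K \<subseteq> \<Omega> \<longrightarrow> bs \<in> lists Basis \<longrightarrow>
       (\<exists>(m::nat) (C::real). \<forall>\<^sub>F \<epsilon> in at_right 0. \<forall>x\<in>K.
          norm (iter_pd bs (u \<epsilon>) x) \<le> C * inverse (\<epsilon> ^ m)))}"

definition null_nets ::
  "'a::euclidean_space set \<Rightarrow> (real \<Rightarrow> 'a \<Rightarrow> 'b::real_normed_vector) set" where
  "null_nets \<Omega> = {u. (\<forall>\<epsilon>\<in>{0<..1}. smooth_on \<Omega> (u \<epsilon>)) \<and>
     (\<forall>K bs. compact K \<longrightarrow> K \<subseteq> \<Omega> \<longrightarrow> bs \<in> lists Basis \<longrightarrow>
       (\<forall>m::nat. \<exists>C::real. \<forall>\<^sub>F \<epsilon> in at_right 0. \<forall>x\<in>K.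
          norm (iter_pd bs (u \<epsilon>) x) \<le> C * \<epsilon> ^ m))}"

definition colombeau_rel ::
  "'a::euclidean_space set \<Rightarrow> (real \<Rightarrow> 'a \<Rightarrow> 'b::real_normed_vector) rel" where
  "colombeau_rel \<Omega> = {(u, v). u \<in> moderate_nets \<Omega> \<and> v \<in> moderate_nets \<Omega> \<and>
     (\<lambda>\<epsilon> x. u \<epsilon> x - v \<epsilon> x) \<in> null_nets \<Omega>}"

definition colombeau ::
  "'a::euclidean_space set \<Rightarrow> (real \<Rightarrow> 'a \<Rightarrow> 'b::real_normed_vector) set set" where
  "colombeau \<Omega> = moderate_nets \<Omega> // colombeau_rel \<Omega>"

definition cl ::
  "'a::euclidean_space set \<Rightarrow> (real \<Rightarrow> 'a \<Rightarrow> 'b::real_normed_vector)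
    \<Rightarrow> (real \<Rightarrow> 'a \<Rightarrow> 'b) set" where
  "cl \<Omega> u = colombeau_rel \<Omega> `` {u}"

text \<open>
  Operations on classes are defined through representatives as a union over the class, as in
  \<open>Equiv_Relations\<close>: if all representatives give the same class, the union is that class.
\<close>

definition colombeau_diff_op ::
  "(real^'p) set \<Rightarrow> ('k::finite \<Rightarrow> 'l::finite \<times> 'p::finite list)
    \<Rightarrow> ((real^'p) \<times> (real^'k) \<Rightarrow> real^'l)
    \<Rightarrow> (real \<Rightarrow> real^'p \<Rightarrow> real^'l) set \<Rightarrow> (real \<Rightarrow> real^'p \<Rightarrow> real^'l) set" where
  "colombeau_diff_op \<Omega> c \<Delta> U = (\<Union>u\<in>U. cl \<Omega> (\<lambda>\<epsilon>. diff_op c \<Delta> (u \<epsilon>)))"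

definition colombeau_solution ::
  "(real^'p) set \<Rightarrow> ('k::finite \<Rightarrow> 'l::finite \<times> 'p::finite list)
    \<Rightarrow> ((real^'p) \<times> (real^'k) \<Rightarrow> real^'l) \<Rightarrow> (real \<Rightarrow> real^'p \<Rightarrow> real^'l) set \<Rightarrow> bool" where
  "colombeau_solution \<Omega> c \<Delta> U \<longleftrightarrow>
     U \<in> colombeau \<Omega> \<and> colombeau_diff_op \<Omega> c \<Delta> U = cl \<Omega> (\<lambda>\<epsilon> x. 0)"

definition colombeau_act ::
  "'a::euclidean_space set \<Rightarrow> ('a \<Rightarrow> 'a) \<Rightarrow> ('a \<times> 'b \<Rightarrow> 'b::euclidean_space)
    \<Rightarrow> (real \<Rightarrow> 'a \<Rightarrow> 'b) set \<Rightarrow> (real \<Rightarrow> 'a \<Rightarrow> 'b) set" where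
  "colombeau_act \<Omega> \<xi> \<phi> U =
     (\<Union>u\<in>U. cl (\<xi> ` \<Omega>) (\<lambda>\<epsilon>. (\<lambda>x. \<phi> (x, u \<epsilon> x)) \<circ> inv_into \<Omega> \<xi>))"

text \<open>
  A class contains, for each fixed index, representatives with arbitrary values there, so
  \<open>g\<^sub>\<eta> U\<close> is defined when \<open>g\<^sub>\<eta>\<close> is defined on all of \<open>\<Omega> \<times> \<real>\<^sup>l\<close>.
\<close>

definition colombeau_symmetry_group ::
  "(real^'p) set \<Rightarrow> ('k::finite \<Rightarrow> 'l::finite \<times> 'p::finite list)
    \<Rightarrow> ((real^'p) \<times> (real^'k) \<Rightarrow> real^'l) \<Rightarrow> (real \<times> (real^'p) \<times> (real^'l)) set
    \<Rightarrow> (real \<Rightarrow> real^'p \<Rightarrow> real^'p) \<Rightarrow> (real \<Rightarrow> (real^'p) \<times> (real^'l) \<Rightarrow> real^'l) \<Rightarrow> bool" where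
  "colombeau_symmetry_group \<Omega> c \<Delta> V \<Xi> \<Phi> \<longleftrightarrow>
     (\<forall>\<eta> U. colombeau_solution \<Omega> c \<Delta> U \<longrightarrow> \<Omega> \<times> UNIV \<subseteq> group_dom V \<eta> \<longrightarrow>
        colombeau_solution (\<Xi> \<eta> ` \<Omega>) c \<Delta> (colombeau_act \<Omega> (\<Xi> \<eta>) (\<Phi> \<eta>) U))"

end

theory Submission
  imports Defs
begin

text \<open>
  A generalized function is represented by a net of smooth functions, and the hypothesis on the
  group speaks of exact smooth solutions. The proof reduces the first to the second. Let
  \<open>U = cl [u\<^sub>\<epsilon>]\<close> solve the linear system \<open>P U = 0\<close>. Then \<open>n\<^sub>\<epsilon> = P u\<^sub>\<epsilon>\<close> is negligible, but in general no
  single \<open>u\<^sub>\<epsilon>\<close> is a solution. Suppose that there is a \<^emph>\<open>negligible\<close> net \<open>v\<^sub>\<epsilon>\<close> with \<open>P v\<^sub>\<epsilon> = n\<^sub>\<epsilon>\<close>. By linearity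
  every \<open>w\<^sub>\<epsilon> = u\<^sub>\<epsilon> - v\<^sub>\<epsilon>\<close> is a smooth solution, and \<open>w\<close> still represents \<open>U\<close>. The classical symmetry property,
  applied for each \<open>\<epsilon>\<close> separately, makes every \<open>g\<^sub>\<eta> w\<^sub>\<epsilon>\<close> a smooth solution on the transformed domain.
  These functions represent \<open>g\<^sub>\<eta> U\<close>, which is therefore a solution in the Colombeau algebra.

  The heart of the matter is the existence of \<open>v\<close> (\<open>null_net_lifting\<close>). It is a consequence of the open
  mapping theorem for \<open>P\<close> on the Frechet space \<open>C\<^sup>\<infinity>(\<Omega>)\<close>: for every seminorm \<open>p\<^sub>m\<close> there are a seminorm
  \<open>q\<^sub>m\<close> and a constant \<open>r\<^sub>m > 0\<close> such that, for all \<open>t > 0\<close> and all \<open>f\<close> with \<open>q\<^sub>m f \<le> t r\<^sub>m\<close>, the equation \<open>P u = f\<close>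
  has a solution with \<open>p\<^sub>m u \<le> t\<close>. As \<open>\<epsilon>\<close> tends to zero, \<open>v\<^sub>\<epsilon>\<close> is chosen with respect to a seminorm of
  index \<open>m = m(\<epsilon>)\<close> that increases so slowly that \<open>q\<^sub>m n\<^sub>\<epsilon> \<le> \<epsilon>\<^sup>m r\<^sub>m\<close>, which gives \<open>p\<^sub>m v\<^sub>\<epsilon> \<le> \<epsilon>\<^sup>m\<close>;
  since the seminorms increase with \<open>m\<close>, all of them are then negligible along \<open>v\<close>.
  The open mapping theorem is proved here in the concrete space, by nested neighbourhoods in place of
  Baire's theorem (\<open>somewhere_approximable\<close>) followed by successive approximation (\<open>open_mapping\<close>);
  both steps rest on the completeness of \<open>C\<^sup>\<infinity>(\<Omega>)\<close> (\<open>telescoping_limit\<close>).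

  The remainder is a calculus of nets. All closure properties (sums, products, compositions, the
  well-definedness of \<open>g\<^sub>\<eta> U\<close>) are proved by induction on the order of differentiation for the sets
  \<open>net_class\<close>, in which smooth functions occur as constant moderate nets. Thus a statement about nets
  contains the corresponding statement about smooth functions.
\<close>

section \<open>Iterated partial derivatives\<close>

lemma iter_pd_append: "iter_pd (as @ bs) f = iter_pd as (iter_pd bs f)"
  by (induction as) auto

lemma differentiable_cong_open:
  assumes "open S" "x \<in> S" "\<And>y. y \<in> S \<Longrightarrow> f y = g y"
  shows "f differentiable (at x) \<longleftrightarrow> g differentiable (at x)"
  using assms has_derivative_transform_within_open[of f _ x UNIV S g]
    has_derivative_transform_within_open[of g _ x UNIV S f]
  unfolding differentiable_def by metis

lemma frechet_derivative_cong_open: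
  assumes "open S" "x \<in> S" "\<And>y. y \<in> S \<Longrightarrow> f y = g y"
  shows "frechet_derivative f (at x) = frechet_derivative g (at x)"
proof -
  have "(f has_derivative D) (at x) \<longleftrightarrow> (g has_derivative D) (at x)" for D
    using assms has_derivative_transform_within_open[of f D x UNIV S g]
      has_derivative_transform_within_open[of g D x UNIV S f] by metis
  then show ?thesis
    unfolding frechet_derivative_def by simp
qed

lemma iter_pd_cong_open:
  assumes "open S" "\<And>y. y \<in> S \<Longrightarrow> f y = g y" "x \<in> S"
  shows "iter_pd bs f x = iter_pd bs g x"
  using assms(3)
proof (induction bs arbitrary: x)
  case Nil
  then show ?case using assms by simp
next
  case (Cons b bs)
  then show ?case
    using frechet_derivative_cong_open[of S x "iter_pd bs f" "iter_pd bs g"] assms(1) by simp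
qed

section \<open>Growth of nets on compact sets\<close>

text \<open>
  The estimates that define moderate and negligible nets have the same closure properties, the
  moderate ones acting on both kinds by multiplication. The parameter \<open>\<gamma>\<close> lets every statement
  be proved once for both.
\<close>

datatype growth = Moderate | Negligible

fun growth_on :: "growth \<Rightarrow> 'a set \<Rightarrow> (real \<Rightarrow> 'a \<Rightarrow> 'b::real_normed_vector) \<Rightarrow> bool" where
  "growth_on Moderate K w \<longleftrightarrow>
     (\<exists>(m::nat) (C::real). \<forall>\<^sub>F \<epsilon> in at_right 0. \<forall>x\<in>K. norm (w \<epsilon> x) \<le> C * inverse (\<epsilon> ^ m))"
| "growth_on Negligible K w \<longleftrightarrow>
     (\<forall>m::nat. \<exists>C::real. \<forall>\<^sub>F \<epsilon> in at_right 0. \<forall>x\<in>K. norm (w \<epsilon> x) \<le> C * \<epsilon> ^ m)"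

declare growth_on.simps [simp del]

lemma eventually_index: "\<forall>\<^sub>F \<epsilon> in at_right (0::real). \<epsilon> \<in> {0<..1}"
  using eventually_at_right_less[of 0] eventually_at_right[of 0 1]
  by (auto simp: eventually_at_right_field intro!: exI[of _ 1])

text \<open>
  The substitution \<open>h\<close> transports estimates from \<open>h ` L \<subseteq> K\<close> to \<open>L\<close>; for \<open>h = id\<close> this is the
  comparison of two nets.
\<close>

lemma growth_on_mono:
  assumes "growth_on \<gamma> K w"
    and "\<forall>\<^sub>F \<epsilon> in at_right 0. \<forall>x\<in>L. norm (v \<epsilon> x) \<le> norm (w \<epsilon> (h x)) \<and> h x \<in> K"
  shows "growth_on \<gamma> L v"
proof -
  have *: "\<forall>\<^sub>F \<epsilon> in at_right 0. \<forall>x\<in>L. norm (v \<epsilon> x) \<le> B \<epsilon>"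
    if "\<forall>\<^sub>F \<epsilon> in at_right 0. \<forall>x\<in>K. norm (w \<epsilon> x) \<le> B \<epsilon>" for B :: "real \<Rightarrow> real"
    using eventually_conj[OF that assms(2)]
    by eventually_elim (meson order_trans)
  show ?thesis
  proof (cases \<gamma>)
    case Moderate
    show ?thesis using assms(1) * unfolding Moderate growth_on.simps by meson
  next
    case Negligible
    show ?thesis using assms(1) * unfolding Negligible growth_on.simps by meson
  qed
qed

lemma growth_on_cong:
  assumes "\<And>\<epsilon> x. \<epsilon> \<in> {0<..1} \<Longrightarrow> x \<in> K \<Longrightarrow> v \<epsilon> x = w \<epsilon> x"
  shows "growth_on \<gamma> K v \<longleftrightarrow> growth_on \<gamma> K w"
proof
  assume "growth_on \<gamma> K v"
  then show "growth_on \<gamma> K w"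
    by (rule growth_on_mono[where h = id]) (use eventually_index in \<open>eventually_elim, simp add: assms\<close>)
next
  assume "growth_on \<gamma> K w"
  then show "growth_on \<gamma> K v"
    by (rule growth_on_mono[where h = id]) (use eventually_index in \<open>eventually_elim, simp add: assms\<close>)
qed

lemma growth_on_add:
  assumes "growth_on \<gamma> K u" "growth_on \<gamma> K v"
  shows "growth_on \<gamma> K (\<lambda>\<epsilon> x. u \<epsilon> x + v \<epsilon> x)"
proof (cases \<gamma>)
  case Moderate
  obtain m C m' C' where
    u: "\<forall>\<^sub>F \<epsilon> in at_right 0. \<forall>x\<in>K. norm (u \<epsilon> x) \<le> C * inverse (\<epsilon> ^ m)" and
    v: "\<forall>\<^sub>F \<epsilon> in at_right 0. \<forall>x\<in>K. norm (v \<epsilon> x) \<le> C' * inverse (\<epsilon> ^ m')"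
    using assms unfolding Moderate growth_on.simps by blast
  have "\<forall>\<^sub>F \<epsilon> in at_right 0. \<forall>x\<in>K. norm (u \<epsilon> x + v \<epsilon> x) \<le> (\<bar>C\<bar> + \<bar>C'\<bar>) * inverse (\<epsilon> ^ (m + m'))"
    using u v eventually_index
  proof eventually_elim
    case (elim \<epsilon>)
    have p: "inverse (\<epsilon> ^ m) \<le> inverse (\<epsilon> ^ (m + m'))" "inverse (\<epsilon> ^ m') \<le> inverse (\<epsilon> ^ (m + m'))"
      using elim(3) by (auto intro!: le_imp_inverse_le power_decreasing)
    have q: "C * inverse (\<epsilon> ^ m) \<le> \<bar>C\<bar> * inverse (\<epsilon> ^ (m + m'))"
      "C' * inverse (\<epsilon> ^ m') \<le> \<bar>C'\<bar> * inverse (\<epsilon> ^ (m + m'))"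
      using p elim(3) by (auto intro!: mult_mono)
    show ?case
    proof
      fix x assume "x \<in> K"
      then have "norm (u \<epsilon> x) \<le> C * inverse (\<epsilon> ^ m)" "norm (v \<epsilon> x) \<le> C' * inverse (\<epsilon> ^ m')"
        using elim by auto
      then show "norm (u \<epsilon> x + v \<epsilon> x) \<le> (\<bar>C\<bar> + \<bar>C'\<bar>) * inverse (\<epsilon> ^ (m + m'))"
        using q norm_triangle_ineq[of "u \<epsilon> x" "v \<epsilon> x"] unfolding distrib_right by linarith
    qed
  qed
  then show ?thesis unfolding Moderate growth_on.simps by blast
next
  case Negligible
  have "\<exists>C. \<forall>\<^sub>F \<epsilon> in at_right 0. \<forall>x\<in>K. norm (u \<epsilon> x + v \<epsilon> x) \<le> C * \<epsilon> ^ m" for m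
  proof -
    obtain C C' where
      u: "\<forall>\<^sub>F \<epsilon> in at_right 0. \<forall>x\<in>K. norm (u \<epsilon> x) \<le> C * \<epsilon> ^ m" and
      v: "\<forall>\<^sub>F \<epsilon> in at_right 0. \<forall>x\<in>K. norm (v \<epsilon> x) \<le> C' * \<epsilon> ^ m"
      using assms unfolding Negligible growth_on.simps by meson
    have "\<forall>\<^sub>F \<epsilon> in at_right 0. \<forall>x\<in>K. norm (u \<epsilon> x + v \<epsilon> x) \<le> (C + C') * \<epsilon> ^ m"
      using u v by eventually_elim (metis distrib_right norm_triangle_mono)
    then show ?thesis by blast
  qed
  then show ?thesis unfolding Negligible growth_on.simps by blast
qed

text \<open>
  Negligible nets form an ideal: a factor \<open>\<epsilon>\<^sup>-\<^sup>m\<close> is absorbed by the estimate of the other factor with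
  exponent \<open>m + k\<close>. The product of the norms, instead of a product of the nets, serves every
  bilinear operation.
\<close>

lemma growth_on_mult:
  assumes "growth_on Moderate K u" "growth_on \<gamma> K v"
  shows "growth_on \<gamma> K (\<lambda>\<epsilon> x. norm (u \<epsilon> x) * norm (v \<epsilon> x))"
proof -
  obtain m C where
    u: "\<forall>\<^sub>F \<epsilon> in at_right 0. \<forall>x\<in>K. norm (u \<epsilon> x) \<le> C * inverse (\<epsilon> ^ m)"
    using assms(1) unfolding growth_on.simps by blast
  show ?thesis
  proof (cases \<gamma>)
    case Moderate
    obtain m' C' where
      v: "\<forall>\<^sub>F \<epsilon> in at_right 0. \<forall>x\<in>K. norm (v \<epsilon> x) \<le> C' * inverse (\<epsilon> ^ m')"
      using assms(2) unfolding Moderate growth_on.simps by blast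
    have "\<forall>\<^sub>F \<epsilon> in at_right 0. \<forall>x\<in>K. norm (u \<epsilon> x) * norm (v \<epsilon> x) \<le> (C * C') * inverse (\<epsilon> ^ (m + m'))"
      using u v eventually_index
    proof eventually_elim
      case (elim \<epsilon>)
      then have "norm (u \<epsilon> x) * norm (v \<epsilon> x) \<le> (C * inverse (\<epsilon> ^ m)) * (C' * inverse (\<epsilon> ^ m'))"
        if "x \<in> K" for x
        using that by (intro mult_mono) (auto intro: order_trans[OF norm_ge_zero])
      then show ?case
        by (simp add: power_add mult_ac)
    qed
    then show ?thesis unfolding Moderate growth_on.simps by (simp, blast)
  next
    case Negligible
    have "\<exists>C. \<forall>\<^sub>F \<epsilon> in at_right 0. \<forall>x\<in>K. norm (u \<epsilon> x) * norm (v \<epsilon> x) \<le> C * \<epsilon> ^ k" for k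
    proof -
      obtain C' where
        v: "\<forall>\<^sub>F \<epsilon> in at_right 0. \<forall>x\<in>K. norm (v \<epsilon> x) \<le> C' * \<epsilon> ^ (m + k)"
        using assms unfolding Negligible growth_on.simps by meson
      have "\<forall>\<^sub>F \<epsilon> in at_right 0. \<forall>x\<in>K. norm (u \<epsilon> x) * norm (v \<epsilon> x) \<le> (C * C') * \<epsilon> ^ k"
        using u v eventually_index
      proof eventually_elim
        case (elim \<epsilon>)
        have "norm (u \<epsilon> x) * norm (v \<epsilon> x) \<le> (C * inverse (\<epsilon> ^ m)) * (C' * \<epsilon> ^ (m + k))"
          if "x \<in> K" for x
          using that elim by (intro mult_mono) (auto intro: order_trans[OF norm_ge_zero])
        moreover have "(C * inverse (\<epsilon> ^ m)) * (C' * \<epsilon> ^ (m + k)) = (C * C') * \<epsilon> ^ k"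
          using elim(3) by (simp add: power_add field_simps)
        ultimately show ?case by simp
      qed
      then show ?thesis by blast
    qed
    then show ?thesis unfolding Negligible growth_on.simps by simp
  qed
qed

lemma growth_on_bounded:
  assumes "\<And>\<epsilon> x. x \<in> K \<Longrightarrow> norm (w \<epsilon> x) \<le> B"
  shows "growth_on Moderate K w"
  by (auto intro!: exI[of _ "0::nat"] exI[of _ B] simp: assms growth_on.simps)

lemma growth_on_zero: "growth_on \<gamma> K (\<lambda>\<epsilon> x. 0)"
  by (cases \<gamma>) (auto intro!: exI[of _ "0::real"] simp: growth_on.simps)

lemma growth_on_norm_le:
  assumes "growth_on \<gamma> K w" "\<And>\<epsilon> x. \<epsilon> \<in> {0<..1} \<Longrightarrow> x \<in> K \<Longrightarrow> norm (v \<epsilon> x) \<le> C * norm (w \<epsilon> x)"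
  shows "growth_on \<gamma> K v"
proof -
  have "growth_on Moderate K (\<lambda>\<epsilon> x. C)"
    by (rule growth_on_bounded[of _ _ "norm C"]) simp
  from growth_on_mult[OF this assms(1)] show ?thesis
    by (rule growth_on_mono[where h = id])
      (use eventually_index in \<open>eventually_elim, force simp: abs_mult intro: order_trans[OF assms(2)] mult_right_mono\<close>)
qed

lemma growth_on_const_mult: "growth_on \<gamma> K w \<Longrightarrow> growth_on \<gamma> K (\<lambda>\<epsilon> x. C * w \<epsilon> x)" for C :: real
  by (rule growth_on_norm_le[where C = "\<bar>C\<bar>"]) (auto simp: abs_mult)

lemma growth_on_power:
  assumes "growth_on Moderate K (w::real \<Rightarrow> 'a \<Rightarrow> real)"
  shows "growth_on Moderate K (\<lambda>\<epsilon> x. w \<epsilon> x ^ m)"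
proof (induction m)
  case 0
  show ?case by (rule growth_on_bounded[of _ _ 1]) simp
next
  case (Suc m)
  from growth_on_mult[OF assms this] show ?case
    by (rule growth_on_norm_le[where C = 1]) (auto simp: abs_mult power_abs)
qed

section \<open>A calculus of moderate and negligible nets\<close>

text \<open>
  The nets whose derivatives of order at most \<open>k\<close> exist and satisfy the estimates of kind \<open>\<gamma>\<close>.
  Product and chain rule express the derivatives of order \<open>k + 1\<close> by objects of order \<open>k\<close>, so that
  closure properties can be proved by induction on \<open>k\<close>; moderate and negligible nets are the
  intersections over all \<open>k\<close>.
\<close>

definition net_class ::
  "growth \<Rightarrow> nat \<Rightarrow> 'a::euclidean_space set \<Rightarrow> (real \<Rightarrow> 'a \<Rightarrow> 'b::real_normed_vector) set" where
  "net_class \<gamma> k S = {u. \<forall>bs\<in>lists Basis. length bs \<le> k \<longrightarrow>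
     (\<forall>\<epsilon>\<in>{0<..1}. \<forall>x\<in>S. iter_pd bs (u \<epsilon>) differentiable (at x)) \<and>
     (\<forall>K. compact K \<longrightarrow> K \<subseteq> S \<longrightarrow> growth_on \<gamma> K (\<lambda>\<epsilon>. iter_pd bs (u \<epsilon>)))}"

lemma net_class_all_iff:
  "(\<forall>k. u \<in> net_class \<gamma> k S) \<longleftrightarrow>
     (\<forall>\<epsilon>\<in>{0<..1}. smooth_on S (u \<epsilon>)) \<and>
     (\<forall>K bs. compact K \<longrightarrow> K \<subseteq> S \<longrightarrow> bs \<in> lists Basis \<longrightarrow> growth_on \<gamma> K (\<lambda>\<epsilon>. iter_pd bs (u \<epsilon>)))"
  unfolding net_class_def smooth_on_def mem_Collect_eq by (meson order_refl)

lemma moderate_nets_eq: "u \<in> moderate_nets S \<longleftrightarrow> (\<forall>k. u \<in> net_class Moderate k S)"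
  unfolding net_class_all_iff moderate_nets_def growth_on.simps mem_Collect_eq by (rule refl)

lemma null_nets_eq: "u \<in> null_nets S \<longleftrightarrow> (\<forall>k. u \<in> net_class Negligible k S)"
  unfolding net_class_all_iff null_nets_def growth_on.simps mem_Collect_eq by (rule refl)

lemma net_class_cong:
  assumes "open S" "\<And>\<epsilon> x. \<epsilon> \<in> {0<..1} \<Longrightarrow> x \<in> S \<Longrightarrow> u \<epsilon> x = v \<epsilon> x"
  shows "u \<in> net_class \<gamma> k S \<longleftrightarrow> v \<in> net_class \<gamma> k S"
proof -
  have eq: "iter_pd bs (u \<epsilon>) x = iter_pd bs (v \<epsilon>) x" if "\<epsilon> \<in> {0<..1}" "x \<in> S" for bs \<epsilon> x
    using iter_pd_cong_open[OF assms(1), of "u \<epsilon>" "v \<epsilon>" x bs] assms(2) that by simp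
  have "iter_pd bs (u \<epsilon>) differentiable (at x) \<longleftrightarrow> iter_pd bs (v \<epsilon>) differentiable (at x)"
    if "\<epsilon> \<in> {0<..1}" "x \<in> S" for bs \<epsilon> x
    using differentiable_cong_open[OF assms(1) that(2)] eq that by metis
  moreover have "growth_on \<gamma> K (\<lambda>\<epsilon>. iter_pd bs (u \<epsilon>)) \<longleftrightarrow> growth_on \<gamma> K (\<lambda>\<epsilon>. iter_pd bs (v \<epsilon>))"
    if "K \<subseteq> S" for K bs
    by (rule growth_on_cong) (use eq that in auto)
  ultimately show ?thesis
    unfolding net_class_def mem_Collect_eq by meson
qed

lemma net_class_iter_pd:
  assumes "u \<in> net_class \<gamma> (length bs + k) S" "bs \<in> lists Basis"
  shows "(\<lambda>\<epsilon>. iter_pd bs (u \<epsilon>)) \<in> net_class \<gamma> k S"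
  using assms unfolding net_class_def mem_Collect_eq iter_pd_append[symmetric]
  by auto

lemma net_class_le:
  "u \<in> net_class \<gamma> k S \<Longrightarrow> j \<le> k \<Longrightarrow> u \<in> net_class \<gamma> j S"
  unfolding net_class_def by auto

lemma net_class_SucI:
  assumes "u \<in> net_class \<gamma> 0 S" "\<And>b. b \<in> Basis \<Longrightarrow> (\<lambda>\<epsilon>. iter_pd [b] (u \<epsilon>)) \<in> net_class \<gamma> k S"
  shows "u \<in> net_class \<gamma> (Suc k) S"
proof -
  have "(\<forall>\<epsilon>\<in>{0<..1}. \<forall>x\<in>S. iter_pd bs (u \<epsilon>) differentiable (at x)) \<and>
     (\<forall>K. compact K \<longrightarrow> K \<subseteq> S \<longrightarrow> growth_on \<gamma> K (\<lambda>\<epsilon>. iter_pd bs (u \<epsilon>)))"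
    if "bs \<in> lists Basis" "length bs \<le> Suc k" for bs
  proof (cases bs rule: rev_cases)
    case Nil
    then show ?thesis using assms(1) unfolding net_class_def by auto
  next
    case (snoc as b)
    with that have "as \<in> lists Basis" "length as \<le> k" "b \<in> Basis" by auto
    with assms(2)[of b] show ?thesis
      unfolding net_class_def mem_Collect_eq snoc iter_pd_append by blast
  qed
  then show ?thesis unfolding net_class_def by blast
qed

lemma frechet_derivative_eq: "(f has_derivative D) (at x) \<Longrightarrow> frechet_derivative f (at x) = D"
  using frechet_derivative_at by metis

lemma net_class_0I:
  assumes "\<And>\<epsilon> x. \<epsilon> \<in> {0<..1} \<Longrightarrow> x \<in> S \<Longrightarrow> u \<epsilon> differentiable (at x)"
    and "\<And>K. compact K \<Longrightarrow> K \<subseteq> S \<Longrightarrow> growth_on \<gamma> K u"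
  shows "u \<in> net_class \<gamma> 0 S"
  using assms unfolding net_class_def by auto

text \<open>
  The induction step of the calculus. A net has order \<open>k\<close> once its derivative is known and the
  partial derivatives have order \<open>k - 1\<close>. The premise on them is conditional on \<open>k = Suc j\<close>, so that
  the case \<open>k = 0\<close> needs no treatment of its own.
\<close>

lemma net_class_derivI:
  assumes "open S"
    and D: "\<And>\<epsilon> x. \<epsilon> \<in> {0<..1} \<Longrightarrow> x \<in> S \<Longrightarrow> (u \<epsilon> has_derivative D \<epsilon> x) (at x)"
    and "\<And>K. compact K \<Longrightarrow> K \<subseteq> S \<Longrightarrow> growth_on \<gamma> K u"
    and Db: "\<And>b j. b \<in> Basis \<Longrightarrow> k = Suc j \<Longrightarrow> (\<lambda>\<epsilon> x. D \<epsilon> x b) \<in> net_class \<gamma> j S"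
  shows "u \<in> net_class \<gamma> k S"
proof -
  have u0: "u \<in> net_class \<gamma> 0 S"
    using assms by (intro net_class_0I) (auto simp: differentiable_def)
  show ?thesis
  proof (cases k)
    case 0
    with u0 show ?thesis by simp
  next
    case (Suc j)
    have "(\<lambda>\<epsilon>. iter_pd [b] (u \<epsilon>)) \<in> net_class \<gamma> j S" if b: "b \<in> Basis" for b
    proof -
      have "frechet_derivative (u \<epsilon>) (at x) b = D \<epsilon> x b" if "\<epsilon> \<in> {0<..1}" "x \<in> S" for \<epsilon> x
        using frechet_derivative_eq[OF D[OF that]] by simp
      then show ?thesis
        using Db[OF b Suc] by (subst net_class_cong[OF assms(1)]) auto
    qed
    then show ?thesis
      unfolding Suc by (rule net_class_SucI[OF u0])
  qed
qed

lemma net_class_growth: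
  "u \<in> net_class \<gamma> k S \<Longrightarrow> compact K \<Longrightarrow> K \<subseteq> S \<Longrightarrow> growth_on \<gamma> K u"
  unfolding net_class_def by (force dest!: bspec[of _ _ "[]"])

lemma net_class_has_derivative:
  "u \<in> net_class \<gamma> k S \<Longrightarrow> \<epsilon> \<in> {0<..1} \<Longrightarrow> x \<in> S \<Longrightarrow>
    (u \<epsilon> has_derivative frechet_derivative (u \<epsilon>) (at x)) (at x)"
  unfolding net_class_def by (force simp: frechet_derivative_works dest!: bspec[of _ _ "[]"])

lemma net_class_pd:
  "u \<in> net_class \<gamma> (Suc k) S \<Longrightarrow> b \<in> Basis \<Longrightarrow>
    (\<lambda>\<epsilon> x. frechet_derivative (u \<epsilon>) (at x) b) \<in> net_class \<gamma> k S"
  using net_class_iter_pd[of u \<gamma> "[b]" k S] by simp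

lemma net_class_add:
  assumes "open S" "u \<in> net_class \<gamma> k S" "v \<in> net_class \<gamma> k S"
  shows "(\<lambda>\<epsilon> x. u \<epsilon> x + v \<epsilon> x) \<in> net_class \<gamma> k S"
  using assms(2,3)
proof (induction k arbitrary: u v rule: less_induct)
  case (less k)
  show ?case
    by (rule net_class_derivI[OF assms(1) has_derivative_add])
      (use less in \<open>auto intro!: growth_on_add net_class_pd less.IH net_class_has_derivative
          intro: net_class_growth\<close>)
qed

lemma net_class_linear:
  assumes "open S" "bounded_linear L" "u \<in> net_class \<gamma> k S"
  shows "(\<lambda>\<epsilon> x. L (u \<epsilon> x)) \<in> net_class \<gamma> k S"
proof -
  interpret bounded_linear L by fact
  obtain B where B: "\<And>y. norm (L y) \<le> B * norm y"
    using nonneg_bounded by (metis mult.commute)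
  from assms(3) show ?thesis
  proof (induction k arbitrary: u rule: less_induct)
    case (less k)
    show ?case
      by (rule net_class_derivI[OF assms(1) has_derivative])
      (use less in \<open>auto intro!: net_class_pd less.IH net_class_has_derivative
          intro: growth_on_norm_le[OF net_class_growth] B\<close>)
  qed
qed

lemma net_class_bilinear:
  assumes "open S" "bounded_bilinear B" "u \<in> net_class Moderate k S" "v \<in> net_class \<gamma> k S"
  shows "(\<lambda>\<epsilon> x. B (u \<epsilon> x) (v \<epsilon> x)) \<in> net_class \<gamma> k S"
proof -
  interpret bounded_bilinear B by fact
  obtain C where C: "\<And>y z. norm (B y z) \<le> C * (norm y * norm z)"
    using bounded by (metis mult.commute)
  have g: "growth_on \<gamma> K (\<lambda>\<epsilon> x. B (u \<epsilon> x) (v \<epsilon> x))"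
    if "u \<in> net_class Moderate k S" "v \<in> net_class \<gamma> k S" "compact K" "K \<subseteq> S" for u v k K
    using growth_on_mult[OF net_class_growth[OF that(1)] net_class_growth[OF that(2)], of K] that
    by (rule_tac growth_on_norm_le[where C = C]) (use C in auto)
  from assms(3,4) show ?thesis
  proof (induction k arbitrary: u v rule: less_induct)
    case (less k)
    have "u \<in> net_class Moderate j S" "v \<in> net_class \<gamma> j S" if "j \<le> k" for j
      using less.prems that by (auto intro: net_class_le)
    then show ?case
      by (intro net_class_derivI[OF assms(1) FDERIV[OF net_class_has_derivative[OF less.prems(1)]
            net_class_has_derivative[OF less.prems(2)]]])
        (auto intro!: g net_class_add[OF assms(1)] less.IH intro: net_class_pd)
  qed
qed

lemma net_class_diff:
  assumes "open S" "u \<in> net_class \<gamma> k S" "v \<in> net_class \<gamma> k S"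
  shows "(\<lambda>\<epsilon> x. u \<epsilon> x - v \<epsilon> x) \<in> net_class \<gamma> k S"
  using net_class_add[OF assms(1,2) net_class_linear[OF assms(1) bounded_linear_minus[OF bounded_linear_ident] assms(3)]]
  by simp

lemma net_class_zero: "open S \<Longrightarrow> (\<lambda>\<epsilon> x. 0) \<in> net_class \<gamma> k S"
proof (induction k rule: less_induct)
  case (less k)
  show ?case
    by (rule net_class_derivI[OF less.prems has_derivative_const])
      (use less in \<open>auto intro!: growth_on_zero\<close>)
qed

lemma net_class_const: "open S \<Longrightarrow> (\<lambda>\<epsilon> x. c) \<in> net_class Moderate k S"
  by (rule net_class_derivI[OF _ has_derivative_const])
    (auto intro!: growth_on_bounded[of _ _ "norm c"] net_class_zero)

lemma net_class_sum:
  assumes "open S" "\<And>i. i \<in> A \<Longrightarrow> u i \<in> net_class \<gamma> k S"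
  shows "(\<lambda>\<epsilon> x. \<Sum>i\<in>A. u i \<epsilon> x) \<in> net_class \<gamma> k S"
proof (cases "finite A")
  case True
  then show ?thesis
    using assms(2) by (induction A) (auto intro: net_class_zero[OF assms(1)] net_class_add[OF assms(1)])
qed (simp add: net_class_zero[OF assms(1)])

lemma net_class_bounded_linear_map:
  fixes L :: "'a::euclidean_space \<Rightarrow> 'b::real_normed_vector"
  assumes "open S" "bounded_linear L"
  shows "(\<lambda>\<epsilon> x. L x) \<in> net_class Moderate k S"
proof (rule net_class_derivI[OF assms(1)])
  fix \<epsilon> :: real and x show "(L has_derivative L) (at x)"
    by (rule bounded_linear_imp_has_derivative[OF assms(2)])
next
  fix K :: "'a set" assume "compact K"
  then have "bounded (L ` K)"
    using assms(2) bounded_linear_image compact_imp_bounded by blast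
  then obtain B where "\<And>y. y \<in> K \<Longrightarrow> norm (L y) \<le> B"
    unfolding bounded_iff by auto
  then show "growth_on Moderate K (\<lambda>\<epsilon>. L)"
    by (rule growth_on_bounded)
qed (use assms in \<open>auto intro: net_class_const\<close>)

lemma net_class_Pair:
  assumes "open S" "u \<in> net_class \<gamma> k S" "v \<in> net_class \<gamma> k S"
  shows "(\<lambda>\<epsilon> x. (u \<epsilon> x, v \<epsilon> x)) \<in> net_class \<gamma> k S"
proof -
  from net_class_add[OF assms(1) net_class_linear[OF assms(1) _ assms(2)]
      net_class_linear[OF assms(1) _ assms(3)], of "\<lambda>y. (y, 0)" "\<lambda>y. (0, y)"]
  show ?thesis
    by (simp add: bounded_linear_Pair bounded_linear_ident bounded_linear_zero)
qed

text \<open>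
  A smooth function is the same as a constant moderate net, because continuous functions are bounded
  on compact sets. Every closure property of nets is therefore also one of smooth functions.
\<close>

lemma smooth_on_iff_net_class:
  "smooth_on S f \<longleftrightarrow> (\<forall>k. (\<lambda>\<epsilon>. f) \<in> net_class Moderate k S)"
proof
  assume f: "smooth_on S f"
  show "\<forall>k. (\<lambda>\<epsilon>. f) \<in> net_class Moderate k S"
    unfolding net_class_all_iff
  proof (intro conjI allI impI ballI)
    fix K and bs :: "'a list" assume K: "compact K" "K \<subseteq> S" "bs \<in> lists Basis"
    then have "continuous_on K (iter_pd bs f)"
      using f unfolding smooth_on_def
      by (meson subsetD continuous_at_imp_continuous_on differentiable_imp_continuous_within)
    then have "bounded (iter_pd bs f ` K)"
      using K compact_continuous_image compact_imp_bounded by blast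
    then obtain B where "\<And>y. y \<in> K \<Longrightarrow> norm (iter_pd bs f y) \<le> B"
      unfolding bounded_iff by auto
    then show "growth_on Moderate K (\<lambda>\<epsilon>. iter_pd bs f)"
      by (rule growth_on_bounded)
  qed (rule f)
next
  assume "\<forall>k. (\<lambda>\<epsilon>. f) \<in> net_class Moderate k S"
  then show "smooth_on S f"
    unfolding net_class_all_iff by (meson greaterThanAtMost_iff order_refl zero_less_one)
qed

text \<open>
  The chain rule in coordinates, with the derivative of \<open>f\<close> resolved into the partial derivatives of
  which \<open>iter_pd\<close> is built.
\<close>

lemma has_derivative_compose_partials:
  fixes h :: "'a::euclidean_space \<Rightarrow> 'b::euclidean_space"
  assumes "(h has_derivative h') (at x)" "f differentiable (at (h x))"
  shows "((\<lambda>x. f (h x)) has_derivative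
    (\<lambda>b. \<Sum>i\<in>Basis. (h' b \<bullet> i) *\<^sub>R frechet_derivative f (at (h x)) i)) (at x)"
proof -
  have f: "(f has_derivative frechet_derivative f (at (h x))) (at (h x))"
    using assms(2) by (simp add: frechet_derivative_works)
  then have "linear (frechet_derivative f (at (h x)))"
    by (simp add: has_derivative_linear)
  then have "frechet_derivative f (at (h x)) y =
      (\<Sum>i\<in>Basis. (y \<bullet> i) *\<^sub>R frechet_derivative f (at (h x)) i)" for y
    by (subst euclidean_representation[of y, symmetric]) (simp add: linear_sum linear_scale)
  then show ?thesis
    by (intro has_derivative_eq_rhs[OF has_derivative_compose[OF assms(1) f]] ext)
qed

text \<open>
  The chain rule writes a derivative of \<open>F \<circ> h\<close> as a sum of products of derivatives of \<open>h\<close> with some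
  \<open>(\<partial>F) \<circ> h\<close>. The induction is over all derivatives of \<open>F\<close> at once, and the estimates on \<open>F\<close> are needed
  only along \<open>h\<close>; they come from slow increase or from the compactness of \<open>h ` K\<close>.
\<close>

lemma net_class_compose:
  fixes h :: "real \<Rightarrow> 'a::euclidean_space \<Rightarrow> 'b::euclidean_space"
    and F :: "real \<Rightarrow> 'b \<Rightarrow> 'c::real_normed_vector"
  assumes S: "open S" and h: "h \<in> net_class Moderate k S"
    and F: "\<And>bs \<epsilon> x. bs \<in> lists Basis \<Longrightarrow> \<epsilon> \<in> {0<..1} \<Longrightarrow> x \<in> S \<Longrightarrow>
        iter_pd bs (F \<epsilon>) differentiable (at (h \<epsilon> x))"
    and growth: "\<And>bs K. bs \<in> lists Basis \<Longrightarrow> compact K \<Longrightarrow> K \<subseteq> S \<Longrightarrow>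
        growth_on \<gamma> K (\<lambda>\<epsilon> x. iter_pd bs (F \<epsilon>) (h \<epsilon> x))"
  shows "(\<lambda>\<epsilon> x. F \<epsilon> (h \<epsilon> x)) \<in> net_class \<gamma> k S"
proof -
  have "(\<lambda>\<epsilon> x. iter_pd bs (F \<epsilon>) (h \<epsilon> x)) \<in> net_class \<gamma> k S" if "bs \<in> lists Basis" for bs
    using h that
  proof (induction k arbitrary: bs rule: less_induct)
    case (less k)
    have "(\<lambda>\<epsilon> x. iter_pd (i # bs) (F \<epsilon>) (h \<epsilon> x)) \<in> net_class \<gamma> j S"
      if "j < k" "i \<in> Basis" for i j
      using less.IH[OF that(1) net_class_le[OF less.prems(1)], of "i # bs"] that less.prems by simp
    then show ?case
      by (intro net_class_derivI[OF S has_derivative_compose_partials[OF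
            net_class_has_derivative[OF less.prems(1)] F[OF less.prems(2)]]])
        (use less.prems in \<open>auto intro!: growth net_class_sum[OF S]
            net_class_bilinear[OF S bounded_bilinear_scaleR]
            net_class_linear[OF S bounded_linear_inner_left] net_class_pd\<close>)
  qed
  from this[of "[]"] show ?thesis by simp
qed

text \<open>
  This is what makes the composition well defined on classes. In the derivative of
  \<open>f \<circ> h - f \<circ> h'\<close> the terms are regrouped as
  \<open>\<partial>h \<cdot> ((\<partial>f) \<circ> h - (\<partial>f) \<circ> h') + \<partial>(h - h') \<cdot> ((\<partial>f) \<circ> h')\<close>. In each summand one factor is moderate and
  the other is negligible, the first by induction, the second by the assumption on \<open>h - h'\<close>.
\<close>

lemma net_class_compose_diff:
  fixes h h' :: "real \<Rightarrow> 'a::euclidean_space \<Rightarrow> 'b::euclidean_space"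
    and f :: "'b \<Rightarrow> 'c::real_normed_vector"
  assumes S: "open S" and h: "h \<in> net_class Moderate k S" "h' \<in> net_class Moderate k S"
    and hh: "(\<lambda>\<epsilon> x. h \<epsilon> x - h' \<epsilon> x) \<in> net_class Negligible k S"
    and f: "\<And>bs \<epsilon> x. bs \<in> lists Basis \<Longrightarrow> \<epsilon> \<in> {0<..1} \<Longrightarrow> x \<in> S \<Longrightarrow>
        iter_pd bs f differentiable (at (h \<epsilon> x)) \<and> iter_pd bs f differentiable (at (h' \<epsilon> x))"
    and growth: "\<And>bs K. bs \<in> lists Basis \<Longrightarrow> compact K \<Longrightarrow> K \<subseteq> S \<Longrightarrow>
        growth_on Moderate K (\<lambda>\<epsilon> x. iter_pd bs f (h' \<epsilon> x))"
    and growth_diff: "\<And>bs K. bs \<in> lists Basis \<Longrightarrow> compact K \<Longrightarrow> K \<subseteq> S \<Longrightarrow>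
        growth_on Negligible K (\<lambda>\<epsilon> x. iter_pd bs f (h \<epsilon> x) - iter_pd bs f (h' \<epsilon> x))"
  shows "(\<lambda>\<epsilon> x. f (h \<epsilon> x) - f (h' \<epsilon> x)) \<in> net_class Negligible k S"
proof -
  have "(\<lambda>\<epsilon> x. iter_pd bs f (h \<epsilon> x) - iter_pd bs f (h' \<epsilon> x)) \<in> net_class Negligible k S"
    if "bs \<in> lists Basis" for bs
    using h hh that
  proof (induction k arbitrary: bs rule: less_induct)
    case (less k)
    define g where "g i = iter_pd (i # bs) f" for i
    let ?D = "\<lambda>h \<epsilon> x. frechet_derivative (h \<epsilon>) (at x)"
    show ?case
    proof (rule net_class_derivI[OF S has_derivative_diff])
      fix \<epsilon> :: real and x assume *: "\<epsilon> \<in> {0<..1}" "x \<in> S"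
      show "((\<lambda>x. iter_pd bs f (h \<epsilon> x)) has_derivative
            (\<lambda>b. \<Sum>i\<in>Basis. (?D h \<epsilon> x b \<bullet> i) *\<^sub>R g i (h \<epsilon> x))) (at x)"
        unfolding g_def iter_pd.simps
        by (rule has_derivative_compose_partials[OF net_class_has_derivative[OF less.prems(1) *]
              f[OF less.prems(4) *, THEN conjunct1]])
      show "((\<lambda>x. iter_pd bs f (h' \<epsilon> x)) has_derivative
            (\<lambda>b. \<Sum>i\<in>Basis. (?D h' \<epsilon> x b \<bullet> i) *\<^sub>R g i (h' \<epsilon> x))) (at x)"
        unfolding g_def iter_pd.simps
        by (rule has_derivative_compose_partials[OF net_class_has_derivative[OF less.prems(2) *]
              f[OF less.prems(4) *, THEN conjunct2]])
    next
      fix b :: 'a and j assume b: "b \<in> Basis" and k: "k = Suc j"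
      have "(\<lambda>\<epsilon> x. \<Sum>i\<in>Basis. ((?D h \<epsilon> x b \<bullet> i) *\<^sub>R (g i (h \<epsilon> x) - g i (h' \<epsilon> x)) +
           ((?D (\<lambda>\<epsilon> x. h \<epsilon> x - h' \<epsilon> x) \<epsilon> x b) \<bullet> i) *\<^sub>R g i (h' \<epsilon> x))) \<in> net_class Negligible j S"
      proof (intro net_class_sum[OF S] net_class_add[OF S])
        fix i :: 'b assume i: "i \<in> Basis"
        have "(\<lambda>\<epsilon> x. g i (h \<epsilon> x) - g i (h' \<epsilon> x)) \<in> net_class Negligible j S"
          unfolding g_def using less.prems k i by (intro less.IH) (auto intro: net_class_le)
        then show "(\<lambda>\<epsilon> x. (?D h \<epsilon> x b \<bullet> i) *\<^sub>R (g i (h \<epsilon> x) - g i (h' \<epsilon> x))) \<in> net_class Negligible j S"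
          using less.prems k b
          by (intro net_class_bilinear[OF S bounded_bilinear_scaleR]
              net_class_linear[OF S bounded_linear_inner_left] net_class_pd) auto
        have "(\<lambda>\<epsilon> x. g i (h' \<epsilon> x)) \<in> net_class Moderate j S"
        proof (rule net_class_compose[OF S, where F = "\<lambda>\<epsilon>. g i"])
          show "h' \<in> net_class Moderate j S"
            using less.prems(2) k by (auto intro: net_class_le)
        qed (use less.prems(4) i f[of "_ @ i # bs"] growth[of "_ @ i # bs"] in
            \<open>auto simp: g_def iter_pd_append simp del: iter_pd.simps\<close>)
        from net_class_bilinear[OF S bounded_bilinear.flip[OF bounded_bilinear_scaleR] this]
        show "(\<lambda>\<epsilon> x. (?D (\<lambda>\<epsilon> x. h \<epsilon> x - h' \<epsilon> x) \<epsilon> x b \<bullet> i) *\<^sub>R g i (h' \<epsilon> x)) \<in> net_class Negligible j S"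
          using less.prems k b
          by (auto intro!: net_class_linear[OF S bounded_linear_inner_left] net_class_pd)
      qed
      also have "?this \<longleftrightarrow> (\<lambda>\<epsilon> x. (\<Sum>i\<in>Basis. (?D h \<epsilon> x b \<bullet> i) *\<^sub>R g i (h \<epsilon> x)) -
           (\<Sum>i\<in>Basis. (?D h' \<epsilon> x b \<bullet> i) *\<^sub>R g i (h' \<epsilon> x))) \<in> net_class Negligible j S"
      proof (rule net_class_cong[OF S])
        fix \<epsilon> :: real and x assume *: "\<epsilon> \<in> {0<..1}" "x \<in> S"
        have "?D (\<lambda>\<epsilon> x. h \<epsilon> x - h' \<epsilon> x) \<epsilon> x = (\<lambda>b. ?D h \<epsilon> x b - ?D h' \<epsilon> x b)"
          using has_derivative_diff[OF net_class_has_derivative[OF less.prems(1) *]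
              net_class_has_derivative[OF less.prems(2) *]]
          by (rule frechet_derivative_eq)
        then show "(\<Sum>i\<in>Basis. ((?D h \<epsilon> x b \<bullet> i) *\<^sub>R (g i (h \<epsilon> x) - g i (h' \<epsilon> x)) +
           ((?D (\<lambda>\<epsilon> x. h \<epsilon> x - h' \<epsilon> x) \<epsilon> x b) \<bullet> i) *\<^sub>R g i (h' \<epsilon> x))) =
           (\<Sum>i\<in>Basis. (?D h \<epsilon> x b \<bullet> i) *\<^sub>R g i (h \<epsilon> x)) -
           (\<Sum>i\<in>Basis. (?D h' \<epsilon> x b \<bullet> i) *\<^sub>R g i (h' \<epsilon> x))"
          by (simp add: sum_subtractf[symmetric] inner_diff_left algebra_simps)
      qed
      finally show "(\<lambda>\<epsilon> x. (\<Sum>i\<in>Basis. (?D h \<epsilon> x b \<bullet> i) *\<^sub>R g i (h \<epsilon> x)) -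
           (\<Sum>i\<in>Basis. (?D h' \<epsilon> x b \<bullet> i) *\<^sub>R g i (h' \<epsilon> x))) \<in> net_class Negligible j S" .
    qed (rule growth_diff[OF less.prems(4)])
  qed
  from this[of "[]"] show ?thesis by simp
qed

section \<open>The Frechet space of smooth functions\<close>

lemma smooth_on_lincomb:
  assumes "open S" "smooth_on S f" "smooth_on S g"
  shows "smooth_on S (\<lambda>x. a *\<^sub>R f x + b *\<^sub>R g x)"
  using assms(2,3) unfolding smooth_on_iff_net_class
  by (auto intro!: net_class_add[OF assms(1)] net_class_linear[OF assms(1) bounded_linear_scaleR_right])

lemma iter_pd_lincomb:
  assumes "open S" "smooth_on S f" "smooth_on S g" "bs \<in> lists Basis" "x \<in> S"
  shows "iter_pd bs (\<lambda>x. a *\<^sub>R f x + b *\<^sub>R g x) x = a *\<^sub>R iter_pd bs f x + b *\<^sub>R iter_pd bs g x"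
  using assms(4,5)
proof (induction bs arbitrary: x rule: list.induct)
  case (Cons i bs)
  have bs: "bs \<in> lists Basis" using Cons.prems(1) by simp
  have "(iter_pd bs f has_derivative frechet_derivative (iter_pd bs f) (at x)) (at x)"
    "(iter_pd bs g has_derivative frechet_derivative (iter_pd bs g) (at x)) (at x)"
    using assms(2,3) bs Cons.prems(2) unfolding smooth_on_def by (auto simp: frechet_derivative_works)
  then have "((\<lambda>x. a *\<^sub>R iter_pd bs f x + b *\<^sub>R iter_pd bs g x) has_derivative
      (\<lambda>h. a *\<^sub>R frechet_derivative (iter_pd bs f) (at x) h + b *\<^sub>R frechet_derivative (iter_pd bs g) (at x) h)) (at x)"
    by (intro has_derivative_add has_derivative_scaleR_right)
  then have "(iter_pd bs (\<lambda>x. a *\<^sub>R f x + b *\<^sub>R g x) has_derivative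
      (\<lambda>h. a *\<^sub>R frechet_derivative (iter_pd bs f) (at x) h + b *\<^sub>R frechet_derivative (iter_pd bs g) (at x) h)) (at x)"
    by (rule has_derivative_transform_within_open[OF _ assms(1) Cons.prems(2)])
      (simp add: Cons.IH[OF bs])
  then show ?case
    by (simp add: frechet_derivative_eq)
qed simp

text \<open>
  The topology of \<open>C\<^sup>\<infinity>(S)\<close> is given by the suprema, over the members of an exhaustion of \<open>S\<close> by compact
  sets, of the derivatives up to a given order. The sets \<open>nb m r\<close> below are the balls of these
  seminorms. Working with balls instead of seminorms avoids suprema over sets that
  may be unbounded for functions outside the space.
\<close>

locale exhaustion =
  fixes S :: "'a::euclidean_space set" and K :: "nat \<Rightarrow> 'a set"
  assumes open_S: "open S"
    and compact_K: "compact (K m)"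
    and K_subset: "K m \<subseteq> S"
    and K_mono: "m \<le> n \<Longrightarrow> K m \<subseteq> K n"
    and K_exhausts: "compact L \<Longrightarrow> L \<subseteq> S \<Longrightarrow> \<exists>m. L \<subseteq> K m"
begin

definition nb :: "nat \<Rightarrow> real \<Rightarrow> ('a \<Rightarrow> 'b::real_normed_vector) set" where
  "nb m r = {f. smooth_on S f \<and>
     (\<forall>bs\<in>lists Basis. length bs \<le> m \<longrightarrow> (\<forall>x\<in>K m. norm (iter_pd bs f x) \<le> r))}"

lemma nb_smooth: "f \<in> nb m r \<Longrightarrow> smooth_on S f"
  unfolding nb_def by simp

lemma nb_le: "f \<in> nb m r \<Longrightarrow> bs \<in> lists Basis \<Longrightarrow> length bs \<le> m \<Longrightarrow> x \<in> K m \<Longrightarrow>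
    norm (iter_pd bs f x) \<le> r"
  unfolding nb_def by simp

lemma nb_mono:
  "f \<in> nb m r \<Longrightarrow> m' \<le> m \<Longrightarrow> r \<le> r' \<Longrightarrow> f \<in> nb m' r'"
  unfolding nb_def mem_Collect_eq using K_mono[of m' m]
  by (meson order_trans subsetD)

lemma nb_lincomb:
  assumes "f \<in> nb m r" "g \<in> nb m s" "\<bar>a\<bar> * r + \<bar>b\<bar> * s \<le> t"
  shows "(\<lambda>x. a *\<^sub>R f x + b *\<^sub>R g x) \<in> nb m t"
proof -
  have "norm (iter_pd bs (\<lambda>x. a *\<^sub>R f x + b *\<^sub>R g x) x) \<le> t"
    if "bs \<in> lists Basis" "length bs \<le> m" "x \<in> K m" for bs x
  proof -
    have "norm (iter_pd bs (\<lambda>x. a *\<^sub>R f x + b *\<^sub>R g x) x)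
        = norm (a *\<^sub>R iter_pd bs f x + b *\<^sub>R iter_pd bs g x)"
      using that K_subset[of m]
      by (subst iter_pd_lincomb[OF open_S nb_smooth[OF assms(1)] nb_smooth[OF assms(2)]]) auto
    also have "\<dots> \<le> \<bar>a\<bar> * r + \<bar>b\<bar> * s"
      using nb_le[OF assms(1) that] nb_le[OF assms(2) that]
      by (intro order_trans[OF norm_triangle_ineq] add_mono) (auto intro!: mult_left_mono)
    finally show ?thesis using assms(3) by simp
  qed
  then show ?thesis
    using smooth_on_lincomb[OF open_S nb_smooth[OF assms(1)] nb_smooth[OF assms(2)]]
    unfolding nb_def by blast
qed

lemma nb_scale:
  "f \<in> nb m r \<Longrightarrow> \<bar>a\<bar> * r \<le> t \<Longrightarrow> (\<lambda>x. a *\<^sub>R f x) \<in> nb m t"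
  using nb_lincomb[of f m r f r a 0 t] by simp

lemma nb_cong:
  assumes "\<And>x. x \<in> S \<Longrightarrow> f x = g x"
  shows "f \<in> nb m r \<longleftrightarrow> g \<in> nb m r"
proof -
  have "iter_pd bs f x = iter_pd bs g x" if "x \<in> S" for bs x
    by (rule iter_pd_cong_open[OF open_S assms that])
  moreover have "smooth_on S f \<longleftrightarrow> smooth_on S g"
    unfolding smooth_on_def
    using differentiable_cong_open[OF open_S] calculation by metis
  ultimately show ?thesis
    unfolding nb_def using K_subset[of m] by (auto simp: subset_iff)
qed

lemma zero_in_nb: "0 \<le> r \<Longrightarrow> (\<lambda>x. 0) \<in> nb m r"
proof -
  assume r: "0 \<le> r"
  have s: "smooth_on S (\<lambda>x. 0)"
    unfolding smooth_on_iff_net_class by (simp add: net_class_const[OF open_S])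
  have "iter_pd bs (\<lambda>x. 0) x = 0" if "bs \<in> lists Basis" "x \<in> S" for bs x
    using iter_pd_lincomb[OF open_S s s that, of 0 0] by simp
  then show ?thesis
    unfolding nb_def mem_Collect_eq using s r K_subset[of m]
    by (metis norm_zero subsetD)
qed

lemma smooth_in_nb:
  assumes "smooth_on S f"
  obtains r where "0 < r" "f \<in> nb m r"
proof -
  let ?B = "{bs. set bs \<subseteq> (Basis::'a set) \<and> length bs \<le> m}"
  have fin: "finite ?B"
    by (rule finite_lists_length_le) simp
  have "bounded (\<Union>bs\<in>?B. iter_pd bs f ` K m)"
  proof (intro bounded_UN fin ballI)
    fix bs assume bs: "bs \<in> ?B"
    have "continuous_on (K m) (iter_pd bs f)"
      using assms bs K_subset[of m] unfolding smooth_on_def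
      by (intro continuous_at_imp_continuous_on ballI differentiable_imp_continuous_within) auto
    then show "bounded (iter_pd bs f ` K m)"
      using compact_K compact_continuous_image compact_imp_bounded by blast
  qed
  then obtain r where "0 < r" "\<And>y. y \<in> (\<Union>bs\<in>?B. iter_pd bs f ` K m) \<Longrightarrow> norm y \<le> r"
    unfolding bounded_pos by auto
  then show ?thesis
    using assms that[of r] unfolding nb_def by (auto simp: subset_iff)
qed

text \<open>
  Completeness of \<open>C\<^sup>\<infinity>(S)\<close>, for sequences whose steps are controlled by seminorms of growing order and
  by radii decreasing at least geometrically. The estimate \<open>r i - r j\<close> for the distance of the
  \<open>j\<close>-th and \<open>i\<close>-th terms telescopes; it gives uniform limits of all derivatives on all members of the
  exhaustion, and uniform convergence allows the derivative to be taken term by term.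
\<close>

lemma telescoping_limit:
  fixes F :: "nat \<Rightarrow> 'a \<Rightarrow> 'b::euclidean_space"
  assumes smooth: "\<And>i. smooth_on S (F i)"
    and step: "\<And>i. (\<lambda>x. F (Suc i) x - F i x) \<in> nb (k i) (r i / 2)"
    and k: "\<And>i. i \<le> k i" "\<And>i. k i \<le> k (Suc i)"
    and r: "\<And>i. 0 < r i" "\<And>i. r (Suc i) \<le> r i / 2"
  obtains f where "smooth_on S f" "\<And>i. (\<lambda>x. f x - F i x) \<in> nb (k i) (r i)"
proof -
  have kmono: "k i \<le> k j" if "i \<le> j" for i j
    using that k(2) by (rule lift_Suc_mono_le[rotated])
  have iter_diff: "iter_pd bs (\<lambda>x. f x - g x) x = iter_pd bs f x - iter_pd bs g x"
    if "bs \<in> lists Basis" "x \<in> S" "smooth_on S f" "smooth_on S g" for bs x and f g :: "'a \<Rightarrow> 'b"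
    using iter_pd_lincomb[OF open_S that(3,4,1,2), of 1 "-1"] by simp
  have dist: "norm (iter_pd bs (F j) x - iter_pd bs (F i) x) \<le> r i - r j"
    if bs: "bs \<in> lists Basis" "length bs \<le> k i" and x: "x \<in> K (k i)" and "i \<le> j" for bs i j x
    using \<open>i \<le> j\<close>
  proof (induction j rule: dec_induct)
    case (step j)
    have "x \<in> K (k j)" "length bs \<le> k j" "x \<in> S"
      using bs x K_mono kmono[of i j] step.hyps K_subset by fastforce+
    then have "norm (iter_pd bs (F (Suc j)) x - iter_pd bs (F j) x) \<le> r j / 2"
      unfolding iter_diff[OF bs(1) \<open>x \<in> S\<close> smooth smooth, symmetric]
      by (intro nb_le[OF assms(2) bs(1)])
    then show ?case
      using step.IH r(2)[of j]
        norm_triangle_ineq[of "iter_pd bs (F (Suc j)) x - iter_pd bs (F j) x" "iter_pd bs (F j) x - iter_pd bs (F i) x"]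
      by simp
  qed simp
  have r_le: "r i \<le> r 0 * (1/2) ^ i" for i
  proof (induction i)
    case (Suc i)
    then show ?case using r(2)[of i] by simp
  qed simp
  have r_lim: "r \<longlonglongrightarrow> 0"
  proof (rule tendsto_sandwich[OF _ _ tendsto_const])
    show "(\<lambda>i. r 0 * (1/2) ^ i) \<longlonglongrightarrow> 0"
      by (rule tendsto_mult_right_zero[OF LIMSEQ_power_zero]) simp
  qed (use r r_le in \<open>auto intro!: always_eventually less_imp_le\<close>)
  \<comment> \<open>\<open>g bs\<close> is the candidate for the derivative \<open>iter_pd bs\<close> of the limit function \<open>g []\<close>.\<close>
  define g where "g bs x = lim (\<lambda>i. iter_pd bs (F i) x)" for bs x
  have lim: "(\<lambda>i. iter_pd bs (F i) x) \<longlonglongrightarrow> g bs x"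
    if bs: "bs \<in> lists Basis" and x: "x \<in> S" for bs x
  proof -
    obtain i0 where i0: "x \<in> K i0"
      using K_exhausts[of "{x}"] x by auto
    have "Cauchy (\<lambda>i. iter_pd bs (F i) x)"
    proof (rule metric_CauchyI)
      fix e :: real assume "0 < e"
      then have "\<forall>\<^sub>F i in sequentially. r i < e / 2 \<and> max i0 (length bs) \<le> i"
        by (intro eventually_conj order_tendstoD(2)[OF r_lim] eventually_ge_at_top) simp
      then obtain i where i: "r i < e / 2" "i0 \<le> i" "length bs \<le> i"
        unfolding eventually_sequentially by auto
      have xi: "x \<in> K (k i)" "length bs \<le> k i"
        using i0 i K_mono[of i0 "k i"] k(1)[of i] by auto
      have *: "dist (iter_pd bs (F m) x) (iter_pd bs (F i) x) < e / 2" if "m \<ge> i" for m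
        using dist[OF bs xi(2,1) that] r(1)[of m] i(1) by (simp add: dist_norm)
      show "\<exists>M. \<forall>m\<ge>M. \<forall>n\<ge>M. dist (iter_pd bs (F m) x) (iter_pd bs (F n) x) < e"
        using * dist_triangle_half_l by blast
    qed
    then show ?thesis
      unfolding g_def using Cauchy_convergent convergent_LIMSEQ_iff by blast
  qed
  have bound: "norm (g bs x - iter_pd bs (F i) x) \<le> r i"
    if bs: "bs \<in> lists Basis" "length bs \<le> k i" and x: "x \<in> K (k i)" for bs i x
  proof (rule Lim_bounded)
    show "(\<lambda>j. norm (iter_pd bs (F j) x - iter_pd bs (F i) x)) \<longlonglongrightarrow> norm (g bs x - iter_pd bs (F i) x)"
      using bs x K_subset by (intro tendsto_intros lim) auto
    show "\<forall>j\<ge>i. norm (iter_pd bs (F j) x - iter_pd bs (F i) x) \<le> r i"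
      using dist[OF bs x] r(1) by (meson diff_le_eq le_add_same_cancel1 less_imp_le order_trans)
  qed
  have deriv: "(g bs has_derivative (\<lambda>h. \<Sum>b\<in>Basis. (h \<bullet> b) *\<^sub>R g (b # bs) x)) (at x)"
    if bs: "bs \<in> lists Basis" and x: "x \<in> S" for bs x
  proof -
    obtain d where d: "0 < d" "cball x d \<subseteq> S"
      using open_S x open_contains_cball by blast
    obtain i0 where i0: "cball x d \<subseteq> K i0"
      using K_exhausts[OF compact_cball d(2)] by blast
    have T: "convex (ball x d)" "x \<in> ball x d" "ball x d \<subseteq> S"
      using d by auto
    have ex: "\<exists>g0. \<forall>y\<in>ball x d. (\<lambda>n. iter_pd bs (F n) y) \<longlonglongrightarrow> g0 y \<and>
        (g0 has_derivative (\<lambda>h. \<Sum>b\<in>Basis. (h \<bullet> b) *\<^sub>R g (b # bs) y)) (at y within ball x d)"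
    proof (rule has_derivative_sequence[OF T(1) _ _ T(2)])
      fix n y assume y: "y \<in> ball x d"
      then have "iter_pd bs (F n) differentiable (at y)"
        using smooth[of n] T bs unfolding smooth_on_def by blast
      from has_derivative_compose_partials[OF has_derivative_ident this]
      have "(iter_pd bs (F n) has_derivative
        (\<lambda>h. \<Sum>b\<in>Basis. (h \<bullet> b) *\<^sub>R iter_pd (b # bs) (F n) y)) (at y)" by simp
      then show "(iter_pd bs (F n) has_derivative
        (\<lambda>h. \<Sum>b\<in>Basis. (h \<bullet> b) *\<^sub>R iter_pd (b # bs) (F n) y)) (at y within ball x d)"
        by (rule has_derivative_at_withinI)
    next
      fix e :: real assume e: "0 < e"
      have "(\<lambda>n. DIM('a) * r n) \<longlonglongrightarrow> 0"
        by (rule tendsto_mult_right_zero[OF r_lim])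
      from order_tendstoD(2)[OF this e] eventually_ge_at_top[of "max i0 (Suc (length bs))"]
      show "\<forall>\<^sub>F n in sequentially. \<forall>y\<in>ball x d. \<forall>h.
          norm ((\<Sum>b\<in>Basis. (h \<bullet> b) *\<^sub>R iter_pd (b # bs) (F n) y) -
                (\<Sum>b\<in>Basis. (h \<bullet> b) *\<^sub>R g (b # bs) y)) \<le> e * norm h"
      proof (eventually_elim, intro ballI allI)
        fix n y h assume n: "DIM('a) * r n < e" "max i0 (Suc (length bs)) \<le> n" and y: "y \<in> ball x d"
        have y': "y \<in> K (k n)" "length bs < k n"
          using y i0 n K_mono[of i0 "k n"] k(1)[of n] by (auto simp: subset_iff)
        have "norm (\<Sum>b\<in>Basis. (h \<bullet> b) *\<^sub>R (iter_pd (b # bs) (F n) y - g (b # bs) y))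
          \<le> (\<Sum>b\<in>(Basis::'a set). norm h * r n)"
        proof (rule sum_norm_le)
          fix b :: 'a assume b: "b \<in> Basis"
          have "norm (iter_pd (b # bs) (F n) y - g (b # bs) y) \<le> r n"
            using bound[of "b # bs" n y] b bs y' by (simp add: norm_minus_commute del: iter_pd.simps)
          then show "norm ((h \<bullet> b) *\<^sub>R (iter_pd (b # bs) (F n) y - g (b # bs) y)) \<le> norm h * r n"
            using Basis_le_norm[OF b, of h] by (auto simp del: iter_pd.simps intro!: mult_mono)
        qed
        also have "\<dots> = (DIM('a) * r n) * norm h" by simp
        also have "\<dots> \<le> e * norm h" using n by (intro mult_right_mono) auto
        finally show "norm ((\<Sum>b\<in>Basis. (h \<bullet> b) *\<^sub>R iter_pd (b # bs) (F n) y) -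
                (\<Sum>b\<in>Basis. (h \<bullet> b) *\<^sub>R g (b # bs) y)) \<le> e * norm h"
          by (simp add: sum_subtractf scaleR_diff_right del: iter_pd.simps)
      qed
    next
      show "(\<lambda>n. iter_pd bs (F n) x) \<longlonglongrightarrow> g bs x"
        by (rule lim[OF bs x])
    qed
    then obtain g0 where g0: "\<And>y. y \<in> ball x d \<Longrightarrow> (\<lambda>n. iter_pd bs (F n) y) \<longlonglongrightarrow> g0 y"
      "(g0 has_derivative (\<lambda>h. \<Sum>b\<in>Basis. (h \<bullet> b) *\<^sub>R g (b # bs) x)) (at x within ball x d)"
      using T(2) by blast
    have eq: "g0 y = g bs y" if "y \<in> ball x d" for y
      using g0(1)[OF that] lim[OF bs] T(3) that LIMSEQ_unique by blast
    have "(g0 has_derivative (\<lambda>h. \<Sum>b\<in>Basis. (h \<bullet> b) *\<^sub>R g (b # bs) x)) (at x)"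
      using g0(2) unfolding at_within_open[OF T(2) open_ball] .
    then show ?thesis
      by (rule has_derivative_transform_within_open[OF _ open_ball T(2) eq])
  qed
  have iter: "iter_pd bs (g []) x = g bs x" if "bs \<in> lists Basis" "x \<in> S" for bs x
    using that
  proof (induction bs arbitrary: x rule: list.induct)
    case (Cons b bs)
    then have b: "b \<in> Basis" and bs: "bs \<in> lists Basis" by auto
    have "iter_pd (b # bs) (g []) x = frechet_derivative (g bs) (at x) b"
      using frechet_derivative_cong_open[OF open_S Cons.prems(2) Cons.IH[OF bs]] by simp
    also have "\<dots> = (\<Sum>b'\<in>Basis. (b \<bullet> b') *\<^sub>R g (b' # bs) x)"
      using frechet_derivative_eq[OF deriv[OF bs Cons.prems(2)]] by simp
    also have "\<dots> = (\<Sum>b'\<in>Basis. if b' = b then g (b' # bs) x else 0)"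
      using b by (intro sum.cong) (auto simp: inner_Basis)
    also have "\<dots> = g (b # bs) x"
      using b by simp
    finally show ?case .
  qed simp
  have g_smooth: "smooth_on S (g [])"
    unfolding smooth_on_def
  proof (intro ballI)
    fix bs :: "'a list" and x assume *: "bs \<in> lists Basis" "x \<in> S"
    show "iter_pd bs (g []) differentiable (at x)"
      using differentiable_cong_open[where f = "iter_pd bs (g [])" and g = "g bs",
          OF open_S *(2) iter[OF *(1)]] differentiableI[OF deriv[OF *]] by blast
  qed
  moreover have "(\<lambda>x. g [] x - F i x) \<in> nb (k i) (r i)" for i
  proof -
    have "smooth_on S (\<lambda>x. g [] x - F i x)"
      using smooth_on_lincomb[OF open_S g_smooth smooth[of i], of 1 "-1"] by simp
    moreover have "norm (iter_pd bs (\<lambda>x. g [] x - F i x) x) \<le> r i"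
      if "bs \<in> lists Basis" "length bs \<le> k i" "x \<in> K (k i)" for bs x
      using bound[OF that] iter_diff[OF that(1) _ g_smooth smooth] iter[OF that(1)] that K_subset
      by (metis subsetD)
    ultimately show ?thesis
      unfolding nb_def by blast
  qed
  ultimately show ?thesis by (rule that)
qed

end

lemma exhaustion_exists:
  fixes S :: "'a::euclidean_space set"
  assumes "open S"
  shows "\<exists>K. exhaustion S K"
proof -
  obtain C :: "nat \<Rightarrow> 'a set" where C: "\<And>n. compact (C n)" "\<And>n. C n \<subseteq> S"
    "\<And>n. C n \<subseteq> interior (C (Suc n))" "\<Union>(range C) = S"
    "\<And>K. \<lbrakk>compact K; K \<subseteq> S\<rbrakk> \<Longrightarrow> \<exists>N. \<forall>n\<ge>N. K \<subseteq> C n"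
    using open_Union_compact_subsets[OF assms] by metis
  have "C m \<subseteq> C n" if "m \<le> n" for m n
    using that by (rule lift_Suc_mono_le[rotated]) (use C(3) interior_subset in blast)
  moreover have "\<exists>m. L \<subseteq> C m" if "compact L" "L \<subseteq> S" for L
    using C(5)[OF that] by blast
  ultimately have "exhaustion S C"
    using assms C(1,2) by (intro exhaustion.intro)
  then show ?thesis by blast
qed

section \<open>Negligible nets and neighbourhoods of zero\<close>

text \<open>
  A sequence that decreases faster than every power of \<open>1 / (i + 1)\<close>. A sequence of functions that
  tends to zero at this rate becomes a negligible net when it is read along \<open>i = \<lfloor>1 / \<epsilon>\<rfloor>\<close>.
\<close>

definition rate :: "nat \<Rightarrow> real" where
  "rate i = (1/2) ^ (i * i)"

lemma rate_pos: "0 < rate i"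
  by (simp add: rate_def)

lemma rate_0: "rate 0 = 1"
  by (simp add: rate_def)

lemma rate_Suc: "rate (Suc i) \<le> rate i / 2"
proof -
  have "rate (Suc i) \<le> (1/2) ^ Suc (i * i)"
    unfolding rate_def by (rule power_decreasing) auto
  then show ?thesis by (simp add: rate_def)
qed

lemma rate_le_power:
  assumes "m \<le> i" "0 < \<epsilon>" "1 / \<epsilon> \<le> real i + 1"
  shows "rate i \<le> \<epsilon> ^ m"
proof -
  have "real i + 1 \<le> 2 ^ i"
    using of_nat_less_two_power[of i, where 'a = real] less_exp[of i]
    by (metis Suc_leI of_nat_Suc of_nat_le_iff of_nat_numeral of_nat_power add.commute)
  then have "(1/2) ^ i \<le> 1 / (real i + 1)"
    by (simp add: power_one_over field_simps)
  then have "rate i \<le> (1 / (real i + 1)) ^ i"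
    unfolding rate_def power_mult by (rule power_mono) simp
  also have "\<dots> \<le> (1 / (real i + 1)) ^ m"
    using assms(1) by (intro power_decreasing) auto
  also have "\<dots> \<le> \<epsilon> ^ m"
    using assms(2,3) by (intro power_mono) (auto simp: field_simps)
  finally show ?thesis .
qed

lemma null_nets_smooth:
  "u \<in> null_nets S \<Longrightarrow> \<epsilon> \<in> {0<..1} \<Longrightarrow> smooth_on S (u \<epsilon>)"
  unfolding null_nets_def by blast

lemma null_nets_bound:
  "u \<in> null_nets S \<Longrightarrow> compact L \<Longrightarrow> L \<subseteq> S \<Longrightarrow> bs \<in> lists Basis \<Longrightarrow>
    \<exists>C. \<forall>\<^sub>F \<epsilon> in at_right 0. \<forall>x\<in>L. norm (iter_pd bs (u \<epsilon>) x) \<le> C * \<epsilon> ^ q"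
  unfolding null_nets_def by simp

context exhaustion
begin

text \<open>
  An estimate with exponent \<open>q + 1\<close> gives one with exponent \<open>q\<close> and an arbitrarily small constant.
  Only finitely many derivatives enter into a single neighbourhood, so one bound on \<open>\<epsilon>\<close> serves them all.
\<close>

lemma null_nets_eventually_nb:
  assumes u: "u \<in> null_nets S" and c: "0 < c"
  shows "\<forall>\<^sub>F \<epsilon> in at_right 0. u \<epsilon> \<in> nb m (c * \<epsilon> ^ q)"
proof -
  let ?B = "{bs. set bs \<subseteq> (Basis::'a set) \<and> length bs \<le> m}"
  have fin: "finite ?B"
    by (rule finite_lists_length_le) simp
  have "\<forall>\<^sub>F \<epsilon> in at_right 0. \<forall>x\<in>K m. norm (iter_pd bs (u \<epsilon>) x) \<le> c * \<epsilon> ^ q" if "bs \<in> ?B" for bs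
  proof -
    have "bs \<in> lists Basis" using that by auto
    then obtain C where C:
      "\<forall>\<^sub>F \<epsilon> in at_right 0. \<forall>x\<in>K m. norm (iter_pd bs (u \<epsilon>) x) \<le> C * \<epsilon> ^ Suc q"
      using null_nets_bound[OF u compact_K K_subset, where q = "Suc q"] by blast
    have "((\<lambda>\<epsilon>. C * \<epsilon>) \<longlongrightarrow> C * 0) (at_right 0)"
      by (intro tendsto_intros)
    then have "\<forall>\<^sub>F \<epsilon> in at_right 0. C * \<epsilon> < c"
      using c by (intro order_tendstoD) auto
    with C eventually_index show ?thesis
    proof eventually_elim
      case (elim \<epsilon>)
      then have "C * \<epsilon> ^ Suc q \<le> c * \<epsilon> ^ q"
        by (simp add: mult.assoc[symmetric] mult_right_mono)
      with elim(1) show ?case by (meson order_trans)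
    qed
  qed
  then have "\<forall>\<^sub>F \<epsilon> in at_right 0. \<forall>bs\<in>?B. \<forall>x\<in>K m. norm (iter_pd bs (u \<epsilon>) x) \<le> c * \<epsilon> ^ q"
    by (intro eventually_ball_finite[OF fin]) blast
  with eventually_index show ?thesis
  proof eventually_elim
    case (elim \<epsilon>)
    then show ?case
      using null_nets_smooth[OF u] unfolding nb_def by auto
  qed
qed

text \<open>
  Coupling the exponent with the index of the seminorm suffices, because the neighbourhoods
  decrease with \<open>m\<close>.
\<close>

lemma null_netsI:
  assumes "\<And>\<epsilon>. \<epsilon> \<in> {0<..1} \<Longrightarrow> smooth_on S (u \<epsilon>)"
    and nb: "\<And>m. \<forall>\<^sub>F \<epsilon> in at_right 0. u \<epsilon> \<in> nb m (c * \<epsilon> ^ m)" and c: "0 \<le> c"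
  shows "u \<in> null_nets S"
proof -
  have "\<exists>C. \<forall>\<^sub>F \<epsilon> in at_right 0. \<forall>x\<in>L. norm (iter_pd bs (u \<epsilon>) x) \<le> C * \<epsilon> ^ q"
    if L: "compact L" "L \<subseteq> S" and bs: "bs \<in> lists Basis" for L bs q
  proof -
    obtain m0 where m0: "L \<subseteq> K m0"
      using K_exhausts[OF L] by blast
    define m where "m = max m0 (max (length bs) q)"
    have Lm: "L \<subseteq> K m" using m0 K_mono[of m0 m] by (auto simp: m_def)
    from nb[of m] eventually_index
    have "\<forall>\<^sub>F \<epsilon> in at_right 0. \<forall>x\<in>L. norm (iter_pd bs (u \<epsilon>) x) \<le> c * \<epsilon> ^ q"
    proof eventually_elim
      case (elim \<epsilon>)
      have "c * \<epsilon> ^ m \<le> c * \<epsilon> ^ q"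
        using elim(2) c by (intro mult_left_mono power_decreasing) (auto simp: m_def)
      moreover have "norm (iter_pd bs (u \<epsilon>) x) \<le> c * \<epsilon> ^ m" if "x \<in> L" for x
        by (rule nb_le[OF elim(1) bs]) (use Lm that in \<open>auto simp: m_def\<close>)
      ultimately show ?case by (meson order_trans)
    qed
    then show ?thesis by blast
  qed
  with assms(1) show ?thesis
    unfolding null_nets_def by blast
qed

lemma floor_net_null:
  assumes w: "\<And>i. w i \<in> nb i (c * rate i)" and c: "0 \<le> c"
  shows "(\<lambda>\<epsilon>. w (nat \<lfloor>1 / \<epsilon>\<rfloor>)) \<in> null_nets S"
proof (rule null_netsI[OF _ _ c])
  fix m :: nat
  have "\<forall>\<^sub>F \<epsilon> in at_right 0. \<epsilon> < 1 / (real m + 1)"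
    using eventually_at_right_field[of _ "0::real"] by (auto intro!: exI[of _ "1 / (real m + 1)"])
  with eventually_index show "\<forall>\<^sub>F \<epsilon> in at_right 0. w (nat \<lfloor>1 / \<epsilon>\<rfloor>) \<in> nb m (c * \<epsilon> ^ m)"
  proof eventually_elim
    case (elim \<epsilon>)
    then have "real m \<le> 1 / \<epsilon>" by (auto simp: field_simps)
    then have m: "m \<le> nat \<lfloor>1 / \<epsilon>\<rfloor>" by linarith
    have "1 / \<epsilon> \<le> real (nat \<lfloor>1 / \<epsilon>\<rfloor>) + 1" by linarith
    with elim m have "rate (nat \<lfloor>1 / \<epsilon>\<rfloor>) \<le> \<epsilon> ^ m"
      by (intro rate_le_power) auto
    with w m c show ?case
      by (blast intro: nb_mono mult_left_mono)
  qed
qed (use w nb_smooth in blast)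

end

section \<open>Open mapping and the lifting of negligible nets\<close>

text \<open>
  The continuity of \<open>P\<close> is expressed by the preservation of negligible nets, a property that the
  calculus of nets provides at once for differential operators.
\<close>

locale surjective_operator = exhaustion S K
  for S :: "'a::euclidean_space set" and K :: "nat \<Rightarrow> 'a set" +
  fixes P :: "('a \<Rightarrow> 'b::euclidean_space) \<Rightarrow> 'a \<Rightarrow> 'c::euclidean_space"
  assumes P_smooth: "smooth_on S u \<Longrightarrow> smooth_on S (P u)"
    and P_lincomb: "smooth_on S u \<Longrightarrow> smooth_on S v \<Longrightarrow> x \<in> S \<Longrightarrow>
      P (\<lambda>x. a *\<^sub>R u x + b *\<^sub>R v x) x = a *\<^sub>R P u x + b *\<^sub>R P v x"
    and P_null: "w \<in> null_nets S \<Longrightarrow> (\<lambda>\<epsilon>. P (w \<epsilon>)) \<in> null_nets S"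
    and P_surj: "smooth_on S f \<Longrightarrow> \<exists>u. smooth_on S u \<and> (\<forall>x\<in>S. P u x = f x)"
begin

lemma P_diff:
  "smooth_on S u \<Longrightarrow> smooth_on S v \<Longrightarrow> x \<in> S \<Longrightarrow> P (\<lambda>x. u x - v x) x = P u x - P v x"
  using P_lincomb[of u v x 1 "-1"] by simp

lemma P_add:
  "smooth_on S u \<Longrightarrow> smooth_on S v \<Longrightarrow> x \<in> S \<Longrightarrow> P (\<lambda>x. u x + v x) x = P u x + P v x"
  using P_lincomb[of u v x 1 1] by simp

lemma P_zero: "x \<in> S \<Longrightarrow> P (\<lambda>x. 0) x = 0"
  using P_lincomb[OF nb_smooth[OF zero_in_nb[of 0]] nb_smooth[OF zero_in_nb[of 0]], of x 0 0] by simp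

text \<open>
  A sequence tending to zero rapidly is turned into a negligible net, to which \<open>P_null\<close> applies;
  the sequence is recovered at the indices \<open>\<epsilon> = 1 / i\<close>.
\<close>

lemma P_sequentially_continuous:
  assumes w: "\<And>i. w i \<in> nb i (c * rate i)" and c: "0 \<le> c" and x: "x \<in> S"
  shows "(\<lambda>i. P (w i) x) \<longlonglongrightarrow> 0"
proof (rule tendstoI)
  fix e :: real assume e: "0 < e"
  obtain m where m: "x \<in> K m"
    using K_exhausts[of "{x}"] x by auto
  have "\<forall>\<^sub>F \<epsilon> in at_right 0. P (w (nat \<lfloor>1 / \<epsilon>\<rfloor>)) \<in> nb m (e / 2 * \<epsilon> ^ 0)"
    by (rule null_nets_eventually_nb[OF P_null[OF floor_net_null[OF w c]]]) (use e in auto)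
  moreover have "filterlim (\<lambda>i. 1 / real i) (at_right 0) sequentially"
    by (rule tendsto_imp_filterlim_at_right[OF lim_1_over_n])
      (use eventually_gt_at_top[of 0] in \<open>eventually_elim, simp\<close>)
  ultimately have "\<forall>\<^sub>F i in sequentially. P (w (nat \<lfloor>1 / (1 / real i)\<rfloor>)) \<in> nb m (e / 2 * (1 / real i) ^ 0)"
    by (rule eventually_compose_filterlim)
  then show "\<forall>\<^sub>F i in sequentially. dist (P (w i) x) 0 < e"
  proof eventually_elim
    case (elim i)
    then have "norm (P (w i) x) \<le> e / 2"
      using nb_le[of "P (w i)" m "e / 2" "[]" x] m by simp
    then show ?case using e by simp
  qed
qed

text \<open>
  \<open>g\<close> lies in the closure of the image of the neighbourhood \<open>nb m t\<close> under \<open>P\<close>.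
\<close>

definition approximable :: "nat \<Rightarrow> real \<Rightarrow> ('a \<Rightarrow> 'c) \<Rightarrow> bool" where
  "approximable m t g \<longleftrightarrow> (\<forall>j s. 0 < s \<longrightarrow> (\<exists>u\<in>nb m t. (\<lambda>x. P u x - g x) \<in> nb j s))"

text \<open>
  Baire's argument. By surjectivity \<open>C\<^sup>\<infinity>(S)\<close> is the union of the images of \<open>nb m N\<close> over all natural \<open>N\<close>.
  If the closures of these images had no interior, nested neighbourhoods could be
  chosen, the \<open>N\<close>-th of which misses the image of \<open>nb m N\<close>. Their common point would have no preimage.
\<close>

lemma somewhere_approximable:
  "\<exists>N f0 k r. 0 < r \<and> smooth_on S f0 \<and> (\<forall>g. (\<lambda>x. g x - f0 x) \<in> nb k r \<longrightarrow> approximable m (real N) g)"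
proof (rule ccontr)
  assume contra: "\<not> ?thesis"
  \<comment> \<open>A state consists of the centre, order and radius of a neighbourhood; \<open>R\<close> says that
    the next one lies inside the present one and misses the image of \<open>nb m i\<close>.\<close>
  define Q where "Q i = (\<lambda>(f::'a \<Rightarrow> 'c, k, r::real). smooth_on S f \<and> i \<le> k \<and> 0 < r)" for i :: nat
  define R where "R i = (\<lambda>(f, k, r) (g, k', r'). (\<lambda>x. g x - f x) \<in> nb k (r / 2) \<and> k \<le> k' \<and> r' \<le> r / 2 \<and>
      (\<forall>u\<in>nb m (real i). (\<lambda>x. P u x - g x) \<notin> nb k' r'))" for i :: nat
  have "\<exists>X. \<forall>i. Q i (X i) \<and> R i (X i) (X (Suc i))"
  proof (rule dependent_nat_choice)
    show "\<exists>z. Q 0 z"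
      using nb_smooth[OF zero_in_nb[of 0]] by (auto simp: Q_def intro!: exI[of _ "\<lambda>x. 0"] exI[of _ "1::real"])
  next
    fix z i assume "Q i z"
    then obtain f k r where z: "z = (f, k, r)" and f: "smooth_on S f" and k: "i \<le> k" and r: "0 < r"
      unfolding Q_def by (cases z) auto
    from contra f r obtain g where g: "(\<lambda>x. g x - f x) \<in> nb k (r / 2)" "\<not> approximable m (real i) g"
      by (meson half_gt_zero)
    then obtain j s where s: "0 < s" and far: "\<And>u. u \<in> nb m (real i) \<Longrightarrow> (\<lambda>x. P u x - g x) \<notin> nb j s"
      unfolding approximable_def by blast
    have "smooth_on S g"
      using smooth_on_lincomb[OF open_S nb_smooth[OF g(1)] f, of 1 1] by simp
    moreover have "(\<lambda>x. P u x - g x) \<notin> nb (max (Suc k) j) (min (r / 2) s)" if "u \<in> nb m (real i)" for u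
      using far[OF that] nb_mono[of "\<lambda>x. P u x - g x" "max (Suc k) j" "min (r / 2) s" j s] by auto
    ultimately have "Q (Suc i) (g, max (Suc k) j, min (r / 2) s) \<and> R i z (g, max (Suc k) j, min (r / 2) s)"
      using g(1) k r s unfolding Q_def R_def z by auto
    then show "\<exists>y. Q (Suc i) y \<and> R i z y" by blast
  qed
  then obtain X where X: "\<And>i. Q i (X i)" "\<And>i. R i (X i) (X (Suc i))" by blast
  define F k r where "F i = fst (X i)" and "k i = fst (snd (X i))" and "r i = snd (snd (X i))" for i
  have XF: "X i = (F i, k i, r i)" for i by (simp add: F_def k_def r_def)
  have QR: "smooth_on S (F i)" "i \<le> k i" "0 < r i"
    "(\<lambda>x. F (Suc i) x - F i x) \<in> nb (k i) (r i / 2)" "k i \<le> k (Suc i)" "r (Suc i) \<le> r i / 2"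
    "\<forall>u\<in>nb m (real i). (\<lambda>x. P u x - F (Suc i) x) \<notin> nb (k (Suc i)) (r (Suc i))" for i
    using X[of i] unfolding Q_def R_def XF by auto
  obtain f where f: "smooth_on S f" "\<And>i. (\<lambda>x. f x - F i x) \<in> nb (k i) (r i)"
    using telescoping_limit[OF QR(1,4,2,5,3,6)] by blast
  obtain u where u: "smooth_on S u" "\<And>x. x \<in> S \<Longrightarrow> P u x = f x"
    using P_surj[OF f(1)] by blast
  obtain c where c: "u \<in> nb m c"
    using smooth_in_nb[OF u(1)] by blast
  obtain i :: nat where i: "c \<le> real i"
    using real_arch_simple by blast
  have "(\<lambda>x. P u x - F (Suc i) x) \<in> nb (k (Suc i)) (r (Suc i))"
    using f(2)[of "Suc i"] by (subst nb_cong) (auto simp: u(2))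
  with QR(7)[of i] nb_mono[OF c order_refl i] show False by blast
qed

text \<open>
  Differences of points in the neighbourhood of \<open>f0\<close> form a neighbourhood of zero, and differences of
  points in the image of \<open>nb m N\<close> lie in the image of \<open>nb m (2 * N)\<close>. Scaling by \<open>c\<close> turns this into
  a statement for all radii; \<open>N + 1\<close> takes the place of \<open>N\<close> only to avoid division by zero.
\<close>

lemma almost_open:
  "\<exists>k r. 0 < r \<and> (\<forall>t>0. \<forall>f\<in>nb k (t * r). approximable m t f)"
proof -
  obtain N f0 k r where r: "0 < r" and f0: "smooth_on S f0"
    and appr: "\<And>g. (\<lambda>x. g x - f0 x) \<in> nb k r \<Longrightarrow> approximable m (real N) g"
    using somewhere_approximable[of m] by blast
  have "approximable m t f" if t: "0 < t" and f: "f \<in> nb k (t * (r / (2 * (real N + 1))))" for t f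
    unfolding approximable_def
  proof (intro allI impI)
    fix j :: nat and s :: real assume s: "0 < s"
    define c where "c = 2 * (real N + 1) / t"
    have c: "0 < c" using t by (simp add: c_def)
    have "(\<lambda>x. (f0 x + c *\<^sub>R f x) - f0 x) \<in> nb k r"
      using nb_scale[OF f, of c r] t c by (simp add: c_def)
    from appr[OF this] obtain u1 where
      u1: "u1 \<in> nb m (real N)" "(\<lambda>x. P u1 x - (f0 x + c *\<^sub>R f x)) \<in> nb j (c * s / 2)"
      unfolding approximable_def using c s by (meson divide_pos_pos mult_pos_pos zero_less_numeral)
    have "(\<lambda>x. f0 x - f0 x) \<in> nb k r"
      using zero_in_nb[of r k] r by simp
    from appr[OF this] obtain u2 where
      u2: "u2 \<in> nb m (real N)" "(\<lambda>x. P u2 x - f0 x) \<in> nb j (c * s / 2)"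
      unfolding approximable_def using c s by (meson divide_pos_pos mult_pos_pos zero_less_numeral)
    define u where "u = (\<lambda>x. (1/c) *\<^sub>R u1 x + (-(1/c)) *\<^sub>R u2 x)"
    have "u \<in> nb m t"
      unfolding u_def
    proof (rule nb_lincomb[OF u1(1) u2(1)])
      have "2 * real N \<le> c * t" using t by (simp add: c_def)
      then show "\<bar>1 / c\<bar> * real N + \<bar>- (1 / c)\<bar> * real N \<le> t"
        using c by (simp add: field_simps)
    qed
    moreover have "(\<lambda>x. P u x - f x) \<in> nb j s"
    proof -
      have "(\<lambda>x. (1/c) *\<^sub>R (P u1 x - (f0 x + c *\<^sub>R f x)) + (-(1/c)) *\<^sub>R (P u2 x - f0 x)) \<in> nb j s"
        using c s by (intro nb_lincomb[OF u1(2) u2(2)]) (simp add: field_simps)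
      also have "?this \<longleftrightarrow> ?thesis"
        unfolding u_def using c
        by (intro nb_cong, subst P_lincomb[OF nb_smooth[OF u1(1)] nb_smooth[OF u2(1)]])
          (auto simp: algebra_simps)
      finally show ?thesis .
    qed
    ultimately show "\<exists>u\<in>nb m t. (\<lambda>x. P u x - f x) \<in> nb j s" by blast
  qed
  moreover have "0 < r / (2 * (real N + 1))" using r by simp
  ultimately show ?thesis by blast
qed

text \<open>
  Successive approximation. The error left by an approximate solution is corrected by another
  approximate solution, taken from a neighbourhood of higher order and smaller radius, so that the
  corrections add up to an exact solution that is still contained in \<open>nb m t\<close>.
\<close>

theorem open_mapping:
  "\<exists>k r. 0 < r \<and> (\<forall>t>0. \<forall>f\<in>nb k (t * r). \<exists>u\<in>nb m t. \<forall>x\<in>S. P u x = f x)"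
proof -
  have "\<forall>i. \<exists>k r. 0 < r \<and> (\<forall>t>0. \<forall>f\<in>nb k (t * r). approximable (m + i) t f)"
    using almost_open by blast
  then obtain \<kappa> \<rho> where \<rho>: "\<And>i::nat. 0 < \<rho> i"
    and appr: "\<And>i t f. 0 < t \<Longrightarrow> f \<in> nb (\<kappa> i) (t * \<rho> i) \<Longrightarrow> approximable (m + i) t f"
    by metis
  have "\<exists>u\<in>nb m t. \<forall>x\<in>S. P u x = f x" if t: "0 < t" and f: "f \<in> nb (\<kappa> 0) (t * (\<rho> 0 / 2))" for t f
  proof -
    define \<tau> where "\<tau> i = t * rate i / 2" for i
    have \<tau>: "0 < \<tau> i" for i using t rate_pos by (simp add: \<tau>_def)
    \<comment> \<open>\<open>Q\<close> says that the error is small enough for the next correction to come from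
      \<open>nb (m + i) (\<tau> i)\<close>; \<open>R\<close> records the size of that correction and of the new error.\<close>
    define Q where "Q i U \<longleftrightarrow> smooth_on S U \<and> (i = 0 \<longrightarrow> U = (\<lambda>x. 0)) \<and>
        (\<lambda>x. f x - P U x) \<in> nb (\<kappa> i) (\<tau> i * \<rho> i)" for i :: nat and U
    define R where "R i U U' \<longleftrightarrow> (\<lambda>x. U' x - U x) \<in> nb (m + i) (\<tau> i) \<and>
        (\<lambda>x. P U' x - f x) \<in> nb (Suc i) (rate i)" for i :: nat and U U'
    have "\<exists>U. \<forall>i. Q i (U i) \<and> R i (U i) (U (Suc i))"
    proof (rule dependent_nat_choice)
      have "(\<lambda>x. f x - P (\<lambda>x. 0) x) \<in> nb (\<kappa> 0) (\<tau> 0 * \<rho> 0)"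
        using f by (subst nb_cong[of _ f]) (auto simp: P_zero \<tau>_def rate_0)
      then show "\<exists>U. Q 0 U"
        using nb_smooth[OF zero_in_nb[of 0]] unfolding Q_def by blast
    next
      fix U i assume Q: "Q i U"
      define s where "s = min (\<tau> (Suc i) * \<rho> (Suc i)) (rate i)"
      have s: "0 < s" using \<tau> \<rho> rate_pos by (simp add: s_def)
      have U: "smooth_on S U" using Q by (simp add: Q_def)
      from Q appr[OF \<tau>] have "approximable (m + i) (\<tau> i) (\<lambda>x. f x - P U x)"
        unfolding Q_def by blast
      then obtain u where u: "u \<in> nb (m + i) (\<tau> i)"
        "(\<lambda>x. P u x - (f x - P U x)) \<in> nb (max (\<kappa> (Suc i)) (Suc i)) s"
        unfolding approximable_def using s by blast
      define U' where "U' = (\<lambda>x. U x + u x)"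
      have PU': "P U' x = P U x + P u x" if "x \<in> S" for x
        unfolding U'_def using P_add[OF U nb_smooth[OF u(1)] that] .
      have "smooth_on S U'"
        using smooth_on_lincomb[OF open_S U nb_smooth[OF u(1)], of 1 1] by (simp add: U'_def)
      moreover have "(\<lambda>x. P U' x - f x) \<in> nb (max (\<kappa> (Suc i)) (Suc i)) s"
        using u(2) by (subst nb_cong[of _ "\<lambda>x. P u x - (f x - P U x)"]) (auto simp: PU')
      moreover from nb_scale[OF this, of "-1" s]
      have "(\<lambda>x. f x - P U' x) \<in> nb (max (\<kappa> (Suc i)) (Suc i)) s"
        using s by simp
      moreover have "(\<lambda>x. U' x - U x) \<in> nb (m + i) (\<tau> i)"
        using u(1) by (simp add: U'_def)
      ultimately have "Q (Suc i) U' \<and> R i U U'"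
        unfolding Q_def R_def s_def by (auto elim!: nb_mono)
      then show "\<exists>y. Q (Suc i) y \<and> R i U y" by blast
    qed
    then obtain U where Q: "\<And>i. Q i (U i)" and R: "\<And>i. R i (U i) (U (Suc i))" by blast
    obtain u where u: "smooth_on S u" "\<And>i. (\<lambda>x. u x - U i x) \<in> nb (m + i) (t * rate i)"
    proof (rule telescoping_limit[of U "\<lambda>i. m + i" "\<lambda>i. t * rate i"])
      show "t * rate (Suc i) \<le> t * rate i / 2" for i
        using mult_left_mono[OF rate_Suc[of i], of t] t by simp
    qed (use Q R t rate_pos in \<open>auto simp: Q_def R_def \<tau>_def\<close>)
    have "u \<in> nb m t"
      using u(2)[of 0] Q[of 0] by (simp add: Q_def rate_0)
    moreover have "P u x = f x" if x: "x \<in> S" for x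
    proof -
      have "(\<lambda>i. P (\<lambda>x. u x - U i x) x) \<longlonglongrightarrow> 0"
        using t by (intro P_sequentially_continuous[of _ t] nb_mono[OF u(2)] x) auto
      then have "(\<lambda>i. P u x - P (U i) x) \<longlonglongrightarrow> 0"
        using Q u(1) x by (simp add: P_diff Q_def)
      then have "(\<lambda>i. P u x - P (U (Suc i)) x) \<longlonglongrightarrow> 0"
        by (rule LIMSEQ_Suc)
      moreover have "(\<lambda>i. P (U (Suc i)) x - f x) \<longlonglongrightarrow> 0"
      proof (rule Lim_null_comparison)
        obtain k where k: "x \<in> K k"
          using K_exhausts[of "{x}"] x by auto
        show "\<forall>\<^sub>F i in sequentially. norm (P (U (Suc i)) x - f x) \<le> (1/2) ^ i"
          using eventually_ge_at_top[of k]
        proof eventually_elim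
          case (elim i)
          then have "x \<in> K (Suc i)" using k K_mono[of k "Suc i"] by auto
          then have "norm (P (U (Suc i)) x - f x) \<le> rate i"
            using R[of i] nb_le[of "\<lambda>x. P (U (Suc i)) x - f x" "Suc i" "rate i" "[]" x] by (simp add: R_def)
          also have "rate i \<le> (1/2) ^ i"
            unfolding rate_def by (rule power_decreasing) auto
          finally show ?case .
        qed
        show "(\<lambda>i. (1/2::real) ^ i) \<longlonglongrightarrow> 0"
          by (rule LIMSEQ_power_zero) simp
      qed
      ultimately have "(\<lambda>i. P u x - f x) \<longlonglongrightarrow> 0 + 0"
        using tendsto_add by force
      then show ?thesis
        using LIMSEQ_unique[OF tendsto_const] by fastforce
    qed
    ultimately show ?thesis by blast
  qed
  moreover have "0 < \<rho> 0 / 2" using \<rho> by simp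
  ultimately show ?thesis by blast
qed

text \<open>
  For a fixed \<open>m\<close> the open mapping theorem solves \<open>P u = n\<^sub>\<epsilon>\<close> in \<open>nb m (\<epsilon>\<^sup>m)\<close> as soon as \<open>\<epsilon> < \<delta> m\<close>.
  A net that is negligible with respect to all seminorms arises if, for each \<open>\<epsilon>\<close>, the largest admissible \<open>m\<close>
  is used. The additional constraint \<open>m \<le> 1 / \<epsilon>\<close> makes this largest \<open>m\<close> exist, and each \<open>m\<close> still becomes
  admissible for small \<open>\<epsilon>\<close>.
\<close>

theorem null_net_lifting:
  assumes n: "n \<in> null_nets S"
  obtains v where "v \<in> null_nets S" "\<And>\<epsilon> x. \<epsilon> \<in> {0<..1} \<Longrightarrow> x \<in> S \<Longrightarrow> P (v \<epsilon>) x = n \<epsilon> x"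
proof -
  have "\<forall>m. \<exists>k r. 0 < r \<and> (\<forall>t>0. \<forall>f\<in>nb k (t * r). \<exists>u\<in>nb m t. \<forall>x\<in>S. P u x = f x)"
    by (intro allI open_mapping)
  then obtain \<kappa> \<rho> where \<rho>: "\<And>m::nat. 0 < \<rho> m"
    and solve: "\<And>m t f. 0 < t \<Longrightarrow> f \<in> nb (\<kappa> m) (t * \<rho> m) \<Longrightarrow> \<exists>u\<in>nb m t. \<forall>x\<in>S. P u x = f x"
    by metis
  have "\<forall>m. \<exists>\<delta>>0. \<forall>\<epsilon>. 0 < \<epsilon> \<and> \<epsilon> < \<delta> \<longrightarrow> n \<epsilon> \<in> nb (\<kappa> m) (\<epsilon> ^ m * \<rho> m)"
  proof
    fix m
    show "\<exists>\<delta>>0. \<forall>\<epsilon>. 0 < \<epsilon> \<and> \<epsilon> < \<delta> \<longrightarrow> n \<epsilon> \<in> nb (\<kappa> m) (\<epsilon> ^ m * \<rho> m)"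
      using null_nets_eventually_nb[OF n \<rho>[of m], of "\<kappa> m" m]
      unfolding eventually_at_right_field by (auto simp: mult.commute)
  qed
  then obtain \<delta> where \<delta>: "\<And>m. 0 < \<delta> m"
    and small: "\<And>m \<epsilon>. 0 < \<epsilon> \<Longrightarrow> \<epsilon> < \<delta> m \<Longrightarrow> n \<epsilon> \<in> nb (\<kappa> m) (\<epsilon> ^ m * \<rho> m)"
    by metis
  have "\<exists>u. smooth_on S u \<and> (\<forall>x\<in>S. P u x = n \<epsilon> x) \<and>
      (\<forall>m. real m \<le> 1 / \<epsilon> \<and> \<epsilon> < \<delta> m \<longrightarrow> u \<in> nb m (\<epsilon> ^ m))"
    if \<epsilon>: "\<epsilon> \<in> {0<..1}" for \<epsilon>
  proof -
    define A where "A = {m::nat. real m \<le> 1 / \<epsilon> \<and> \<epsilon> < \<delta> m}"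
    have "A \<subseteq> {..nat \<lfloor>1 / \<epsilon>\<rfloor>}"
      unfolding A_def by (auto simp: le_nat_floor)
    then have fin: "finite A" by (rule finite_subset) simp
    show ?thesis
    proof (cases "A = {}")
      case True
      then show ?thesis
        using P_surj[OF null_nets_smooth[OF n \<epsilon>]] unfolding A_def by blast
    next
      case False
      then have M: "Max A \<in> A" using fin by simp
      then obtain u where u: "u \<in> nb (Max A) (\<epsilon> ^ Max A)" "\<forall>x\<in>S. P u x = n \<epsilon> x"
        using solve[OF _ small[of \<epsilon> "Max A"]] \<epsilon> unfolding A_def by auto
      have "u \<in> nb m (\<epsilon> ^ m)" if "m \<in> A" for m
        using u(1) Max_ge[OF fin that] \<epsilon> by (auto elim!: nb_mono intro!: power_decreasing)
      with u nb_smooth[OF u(1)] show ?thesis unfolding A_def by blast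
    qed
  qed
  then obtain v where v: "\<And>\<epsilon>. \<epsilon> \<in> {0<..1} \<Longrightarrow> smooth_on S (v \<epsilon>)"
    "\<And>\<epsilon> x. \<epsilon> \<in> {0<..1} \<Longrightarrow> x \<in> S \<Longrightarrow> P (v \<epsilon>) x = n \<epsilon> x"
    "\<And>\<epsilon> m. \<epsilon> \<in> {0<..1} \<Longrightarrow> real m \<le> 1 / \<epsilon> \<Longrightarrow> \<epsilon> < \<delta> m \<Longrightarrow> v \<epsilon> \<in> nb m (\<epsilon> ^ m)"
    by metis
  have "v \<in> null_nets S"
  proof (rule null_netsI[of v 1])
    fix m :: nat
    have "\<forall>\<^sub>F \<epsilon> in at_right 0. \<epsilon> < min (\<delta> m) (1 / (real m + 1))"
      using \<delta>[of m] eventually_at_right_field[of _ "0::real"]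
      by (auto intro!: exI[of _ "min (\<delta> m) (1 / (real m + 1))"])
    with eventually_index show "\<forall>\<^sub>F \<epsilon> in at_right 0. v \<epsilon> \<in> nb m (1 * \<epsilon> ^ m)"
    proof eventually_elim
      case (elim \<epsilon>)
      then have "real m \<le> 1 / \<epsilon>" by (auto simp: field_simps)
      with v(3)[of \<epsilon> m] elim show ?case by simp
    qed
  qed (use v(1) in auto)
  with v(2) show ?thesis by (rule that[rotated])
qed

end

section \<open>Composition of smooth functions\<close>

lemma smooth_on_subset: "smooth_on T f \<Longrightarrow> S \<subseteq> T \<Longrightarrow> smooth_on S f"
  unfolding smooth_on_def by blast

lemma smooth_on_cong:
  assumes "open S" "\<And>x. x \<in> S \<Longrightarrow> f x = g x"
  shows "smooth_on S f \<longleftrightarrow> smooth_on S g"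
  unfolding smooth_on_iff_net_class by (intro iff_allI net_class_cong assms)

lemma smooth_on_imp_continuous_on: "smooth_on S f \<Longrightarrow> continuous_on S f"
  unfolding smooth_on_def
  by (intro continuous_at_imp_continuous_on ballI differentiable_imp_continuous_within)
    (force dest: bspec[of _ _ "[]"])

text \<open>
  Since \<open>\<sigma>\<close> maps compact sets to compact sets, the estimates on \<open>T\<close> give the estimates along \<open>\<sigma>\<close>
  that the chain rule requires.
\<close>

lemma net_class_pullback:
  assumes S: "open S" and \<sigma>: "smooth_on S \<sigma>" "\<sigma> ` S \<subseteq> T" and u: "\<And>k. u \<in> net_class \<gamma> k T"
  shows "(\<lambda>\<epsilon> x. u \<epsilon> (\<sigma> x)) \<in> net_class \<gamma> k S"
proof (rule net_class_compose[OF S])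
  show "(\<lambda>\<epsilon>. \<sigma>) \<in> net_class Moderate k S"
    using \<sigma>(1) unfolding smooth_on_iff_net_class by blast
  have all: "(\<forall>\<epsilon>\<in>{0<..1}. smooth_on T (u \<epsilon>)) \<and>
     (\<forall>K bs. compact K \<longrightarrow> K \<subseteq> T \<longrightarrow> bs \<in> lists Basis \<longrightarrow> growth_on \<gamma> K (\<lambda>\<epsilon>. iter_pd bs (u \<epsilon>)))"
    using u unfolding net_class_all_iff[symmetric] by blast
  fix bs :: "'b list" assume bs: "bs \<in> lists Basis"
  show "iter_pd bs (u \<epsilon>) differentiable (at (\<sigma> x))" if "\<epsilon> \<in> {0<..1}" "x \<in> S" for \<epsilon> x
    using all that bs \<sigma>(2) unfolding smooth_on_def by blast
  fix K assume K: "compact K" "K \<subseteq> S"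
  have "compact (\<sigma> ` K)" "\<sigma> ` K \<subseteq> T"
    using K \<sigma> smooth_on_imp_continuous_on[OF \<sigma>(1)]
    by (auto intro!: compact_continuous_image intro: continuous_on_subset)
  with all bs have "growth_on \<gamma> (\<sigma> ` K) (\<lambda>\<epsilon>. iter_pd bs (u \<epsilon>))" by blast
  then show "growth_on \<gamma> K (\<lambda>\<epsilon> x. iter_pd bs (u \<epsilon>) (\<sigma> x))"
    by (rule growth_on_mono[where h = \<sigma>]) auto
qed

lemma smooth_on_compose:
  assumes "open S" "smooth_on S \<sigma>" "\<sigma> ` S \<subseteq> T" "smooth_on T f"
  shows "smooth_on S (\<lambda>x. f (\<sigma> x))"
  using net_class_pullback[OF assms(1-3), of "\<lambda>\<epsilon>. f"] assms(4)
  unfolding smooth_on_iff_net_class by blast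

lemma smooth_on_Pair:
  assumes "open S" "smooth_on S f" "smooth_on S g"
  shows "smooth_on S (\<lambda>x. (f x, g x))"
  using assms net_class_Pair[OF assms(1), of "\<lambda>\<epsilon>. f" _ _ "\<lambda>\<epsilon>. g"]
  unfolding smooth_on_iff_net_class by blast

lemma smooth_on_const: "open S \<Longrightarrow> smooth_on S (\<lambda>x. c)"
  unfolding smooth_on_iff_net_class by (simp add: net_class_const)

lemma smooth_on_linear: "open S \<Longrightarrow> bounded_linear f \<Longrightarrow> smooth_on S f"
  unfolding smooth_on_iff_net_class using net_class_bounded_linear_map by blast

section \<open>Linear differential operators\<close>

lemma diff_op_expand:
  assumes "linear (\<lambda>w. \<Delta> (x, w))"
  shows "diff_op c \<Delta> u x = (\<Sum>k\<in>UNIV. (prolong c u x $ k) *\<^sub>R \<Delta> (x, axis k 1))"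
proof -
  have "diff_op c \<Delta> u x = \<Delta> (x, \<Sum>k\<in>UNIV. (prolong c u x $ k) *\<^sub>R axis k 1)"
    unfolding diff_op_def using basis_expansion[of "prolong c u x"]
    by (simp add: scalar_mult_eq_scaleR)
  also have "\<dots> = (\<Sum>k\<in>UNIV. (prolong c u x $ k) *\<^sub>R \<Delta> (x, axis k 1))"
    by (simp add: linear_sum[OF assms] linear_scale[OF assms])
  finally show ?thesis .
qed

text \<open>
  Linearity in the jet variables makes \<open>diff_op c \<Delta>\<close> a sum of smooth coefficients \<open>\<Delta> (x, axis k 1)\<close>
  times partial derivatives of \<open>u\<close> (\<open>diff_op_expand\<close>). Hence it maps moderate nets to moderate nets and
  negligible ones to negligible ones.
\<close>

locale linear_diff_op =
  fixes c :: "'k::finite \<Rightarrow> 'l::finite \<times> 'p::finite list"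
    and \<Delta> :: "(real^'p) \<times> (real^'k) \<Rightarrow> real^'l"
    and S :: "(real^'p) set"
  assumes open_S: "open S"
    and smooth_\<Delta>: "smooth_on (S \<times> UNIV) \<Delta>"
    and linear_\<Delta>: "x \<in> S \<Longrightarrow> linear (\<lambda>w. \<Delta> (x, w))"
begin

lemma axis_list_Basis: "map (\<lambda>i. axis i (1::real)) is \<in> lists Basis"
  by (auto simp: axis_in_Basis_iff)

lemma diff_op_lincomb:
  assumes "smooth_on S u" "smooth_on S v" "x \<in> S"
  shows "diff_op c \<Delta> (\<lambda>x. a *\<^sub>R u x + b *\<^sub>R v x) x = a *\<^sub>R diff_op c \<Delta> u x + b *\<^sub>R diff_op c \<Delta> v x"
proof -
  have "prolong c (\<lambda>x. a *\<^sub>R u x + b *\<^sub>R v x) x = a *\<^sub>R prolong c u x + b *\<^sub>R prolong c v x"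
    unfolding prolong_def
    by (simp add: vec_eq_iff iter_pd_lincomb[OF open_S assms(1,2) axis_list_Basis assms(3)])
  then show ?thesis
    using linear_add[OF linear_\<Delta>[OF assms(3)]] linear_scale[OF linear_\<Delta>[OF assms(3)]]
    unfolding diff_op_def by simp
qed

lemma diff_op_net_class:
  assumes "\<And>k. u \<in> net_class \<gamma> k S"
  shows "(\<lambda>\<epsilon>. diff_op c \<Delta> (u \<epsilon>)) \<in> net_class \<gamma> k S"
proof -
  have "(\<lambda>\<epsilon> x. \<Sum>i\<in>UNIV. (prolong c (u \<epsilon>) x $ i) *\<^sub>R \<Delta> (x, axis i 1)) \<in> net_class \<gamma> k S"
  proof (rule net_class_sum[OF open_S])
    fix i
    have "smooth_on S (\<lambda>x. \<Delta> (x, axis i 1))"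
      by (rule smooth_on_compose[OF open_S _ _ smooth_\<Delta>])
        (auto intro!: smooth_on_Pair[OF open_S smooth_on_linear[OF open_S bounded_linear_ident]]
          smooth_on_const[OF open_S])
    then have "(\<lambda>\<epsilon> x. \<Delta> (x, axis i 1)) \<in> net_class Moderate k S"
      unfolding smooth_on_iff_net_class by blast
    moreover have "(\<lambda>\<epsilon> x. prolong c (u \<epsilon>) x $ i) \<in> net_class \<gamma> k S"
      unfolding prolong_def using assms
      by (auto intro!: net_class_linear[OF open_S bounded_linear_vec_nth] net_class_iter_pd axis_list_Basis)
    ultimately show "(\<lambda>\<epsilon> x. (prolong c (u \<epsilon>) x $ i) *\<^sub>R \<Delta> (x, axis i 1)) \<in> net_class \<gamma> k S"
      by (rule net_class_bilinear[OF open_S bounded_bilinear.flip[OF bounded_bilinear_scaleR]])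
  qed
  also have "?this \<longleftrightarrow> ?thesis"
    by (rule net_class_cong[OF open_S]) (simp add: diff_op_expand linear_\<Delta>)
  finally show ?thesis .
qed

lemma diff_op_moderate:
  "u \<in> moderate_nets S \<Longrightarrow>
    (\<lambda>\<epsilon>. diff_op c \<Delta> (u \<epsilon>)) \<in> moderate_nets S"
  unfolding moderate_nets_eq using diff_op_net_class by blast

lemma diff_op_null:
  "u \<in> null_nets S \<Longrightarrow>
    (\<lambda>\<epsilon>. diff_op c \<Delta> (u \<epsilon>)) \<in> null_nets S"
  unfolding null_nets_eq using diff_op_net_class by blast

lemma diff_op_smooth: "smooth_on S u \<Longrightarrow> smooth_on S (diff_op c \<Delta> u)"
  unfolding smooth_on_iff_net_class using diff_op_net_class[of "\<lambda>\<epsilon>. u"] by blast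

end

section \<open>Colombeau classes\<close>

lemma moderate_nets_smooth:
  "u \<in> moderate_nets S \<Longrightarrow> \<epsilon> \<in> {0<..1} \<Longrightarrow> smooth_on S (u \<epsilon>)"
  unfolding moderate_nets_def by blast

lemma null_nets_subset_moderate_nets:
  assumes "u \<in> null_nets S" shows "u \<in> moderate_nets S"
proof -
  have "\<exists>C. \<forall>\<^sub>F \<epsilon> in at_right 0. \<forall>x\<in>L. norm (iter_pd bs (u \<epsilon>) x) \<le> C * inverse (\<epsilon> ^ 0)"
    if "compact L" "L \<subseteq> S" "bs \<in> lists Basis" for L bs
    using null_nets_bound[OF assms that, of 0] by simp
  then show ?thesis
    unfolding moderate_nets_def using null_nets_smooth[OF assms] by blast
qed

lemma null_nets_add:
  "open S \<Longrightarrow> u \<in> null_nets S \<Longrightarrow> v \<in> null_nets S \<Longrightarrow>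
    (\<lambda>\<epsilon> x. u \<epsilon> x + v \<epsilon> x) \<in> null_nets S"
  unfolding null_nets_eq using net_class_add by blast

lemma null_nets_diff:
  "open S \<Longrightarrow> u \<in> null_nets S \<Longrightarrow> v \<in> null_nets S \<Longrightarrow>
    (\<lambda>\<epsilon> x. u \<epsilon> x - v \<epsilon> x) \<in> null_nets S"
  unfolding null_nets_eq using net_class_diff by blast

lemma moderate_nets_diff:
  "open S \<Longrightarrow> u \<in> moderate_nets S \<Longrightarrow> v \<in> moderate_nets S \<Longrightarrow>
    (\<lambda>\<epsilon> x. u \<epsilon> x - v \<epsilon> x) \<in> moderate_nets S"
  unfolding moderate_nets_eq using net_class_diff by blast

lemma zero_null_net: "open S \<Longrightarrow> (\<lambda>\<epsilon> x. 0) \<in> null_nets S"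
  unfolding null_nets_eq using net_class_zero by blast

lemma null_nets_cong:
  "open S \<Longrightarrow> (\<And>\<epsilon> x. \<epsilon> \<in> {0<..1} \<Longrightarrow> x \<in> S \<Longrightarrow> u \<epsilon> x = v \<epsilon> x) \<Longrightarrow> u \<in> null_nets S \<longleftrightarrow> v \<in> null_nets S"
  unfolding null_nets_eq by (intro iff_allI net_class_cong)

lemma equiv_colombeau_rel:
  assumes "open S"
  shows "equiv (moderate_nets S) (colombeau_rel S)"
proof (rule equivI)
  show "colombeau_rel S \<subseteq> moderate_nets S \<times> moderate_nets S"
    unfolding colombeau_rel_def by blast
  show "refl_on (moderate_nets S) (colombeau_rel S)"
    unfolding refl_on_def colombeau_rel_def by (simp add: zero_null_net[OF assms])
  show "sym (colombeau_rel S)"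
    unfolding sym_def colombeau_rel_def
    using null_nets_diff[OF assms zero_null_net[OF assms]] by fastforce
  show "trans (colombeau_rel S)"
    unfolding trans_def colombeau_rel_def
    using null_nets_add[OF assms] by fastforce
qed

lemma cl_in_colombeau: "u \<in> moderate_nets S \<Longrightarrow> cl S u \<in> colombeau S"
  unfolding colombeau_def cl_def by (rule quotientI)

lemma cl_eq_iff:
  assumes "open S" "u \<in> moderate_nets S" "v \<in> moderate_nets S"
  shows "cl S u = cl S v \<longleftrightarrow> (\<lambda>\<epsilon> x. u \<epsilon> x - v \<epsilon> x) \<in> null_nets S"
  using eq_equiv_class_iff[OF equiv_colombeau_rel[OF assms(1)] assms(2,3)] assms(2,3)
  unfolding cl_def colombeau_rel_def by simp

lemma mem_cl: "open S \<Longrightarrow> u \<in> moderate_nets S \<Longrightarrow> u \<in> cl S u"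
  unfolding cl_def by (rule equiv_class_self[OF equiv_colombeau_rel])

lemma mem_cl_iff:
  "v \<in> cl S u \<longleftrightarrow> u \<in> moderate_nets S \<and> v \<in> moderate_nets S \<and> (\<lambda>\<epsilon> x. u \<epsilon> x - v \<epsilon> x) \<in> null_nets S"
  unfolding cl_def colombeau_rel_def by simp

context linear_diff_op
begin

text \<open>
  The operator is well defined on classes: by linearity it maps the difference of two representatives,
  a negligible net, to the difference of the images.
\<close>

lemma colombeau_diff_op_cl:
  assumes u: "u \<in> moderate_nets S"
  shows "colombeau_diff_op S c \<Delta> (cl S u) = cl S (\<lambda>\<epsilon>. diff_op c \<Delta> (u \<epsilon>))"
proof -
  have "cl S (\<lambda>\<epsilon>. diff_op c \<Delta> (v \<epsilon>)) = cl S (\<lambda>\<epsilon>. diff_op c \<Delta> (u \<epsilon>))" if v: "v \<in> cl S u" for v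
  proof -
    from v have v': "v \<in> moderate_nets S" and "(\<lambda>\<epsilon> x. u \<epsilon> x - v \<epsilon> x) \<in> null_nets S"
      unfolding mem_cl_iff by auto
    from diff_op_null[OF this(2)]
    have "(\<lambda>\<epsilon>. diff_op c \<Delta> (\<lambda>x. u \<epsilon> x - v \<epsilon> x)) \<in> null_nets S" .
    also have "?this \<longleftrightarrow> (\<lambda>\<epsilon> x. diff_op c \<Delta> (u \<epsilon>) x - diff_op c \<Delta> (v \<epsilon>) x) \<in> null_nets S"
      using diff_op_lincomb[OF moderate_nets_smooth[OF u] moderate_nets_smooth[OF v'], of _ _ _ 1 "-1"]
      by (intro null_nets_cong[OF open_S]) simp
    finally show ?thesis
      using cl_eq_iff[OF open_S diff_op_moderate[OF u] diff_op_moderate[OF v']] by simp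
  qed
  then show ?thesis
    unfolding colombeau_diff_op_def using mem_cl[OF open_S u] by blast
qed

lemma colombeau_solution_cl_iff:
  assumes u: "u \<in> moderate_nets S"
  shows "colombeau_solution S c \<Delta> (cl S u) \<longleftrightarrow> (\<lambda>\<epsilon>. diff_op c \<Delta> (u \<epsilon>)) \<in> null_nets S"
  using cl_eq_iff[OF open_S diff_op_moderate[OF u] null_nets_subset_moderate_nets[OF zero_null_net[OF open_S]]]
  unfolding colombeau_solution_def colombeau_diff_op_cl[OF u] by (simp add: cl_in_colombeau[OF u])

end

section \<open>Slowly increasing transformations\<close>

lemma growth_on_sum:
  assumes "\<And>i. i \<in> A \<Longrightarrow> growth_on \<gamma> K (w i)"
  shows "growth_on \<gamma> K (\<lambda>\<epsilon> x. \<Sum>i\<in>A. w i \<epsilon> x)"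
proof (cases "finite A")
  case True
  then show ?thesis
    using assms by (induction A) (auto intro: growth_on_zero growth_on_add)
qed (simp add: growth_on_zero)

lemma growth_on_one_plus_power:
  assumes "growth_on Moderate K (u :: real \<Rightarrow> 'a \<Rightarrow> real)"
  shows "growth_on Moderate K (\<lambda>\<epsilon> x. (1 + u \<epsilon> x) ^ m)"
  by (intro growth_on_power growth_on_add assms growth_on_bounded[of _ _ 1]) simp

lemma growth_on_norm:
  "growth_on \<gamma> K u \<Longrightarrow> growth_on \<gamma> K (\<lambda>\<epsilon> x. norm (u \<epsilon> x))"
  by (rule growth_on_norm_le[where C = 1]) auto

text \<open>
  The action of a fixed group element, with base map \<open>\<xi>\<close> and fibre map \<open>\<phi>\<close>, on functions over \<open>\<Omega>\<close>.
  That \<open>\<phi>\<close> is defined on all of \<open>\<Omega> \<times> UNIV\<close> is essential for differences: the segment joining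
  two points of a fibre has to stay in the domain.
\<close>

locale slow_transformation =
  fixes \<Omega> :: "'a::euclidean_space set" and W :: "('a \<times> 'b::euclidean_space) set"
    and \<xi> :: "'a \<Rightarrow> 'a" and \<phi> :: "'a \<times> 'b \<Rightarrow> 'b"
  assumes open_\<Omega>: "open \<Omega>"
    and open_image: "open (\<xi> ` \<Omega>)"
    and smooth_inv: "smooth_on (\<xi> ` \<Omega>) (inv_into \<Omega> \<xi>)"
    and slow: "slowly_increasing W \<phi>"
    and dom: "\<Omega> \<times> UNIV \<subseteq> W"
begin

definition act :: "(real \<Rightarrow> 'a \<Rightarrow> 'b) \<Rightarrow> real \<Rightarrow> 'a \<Rightarrow> 'b" where
  "act u = (\<lambda>\<epsilon>. (\<lambda>x. \<phi> (x, u \<epsilon> x)) \<circ> inv_into \<Omega> \<xi>)"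

lemma differentiable_\<phi>: "bs \<in> lists Basis \<Longrightarrow> x \<in> \<Omega> \<Longrightarrow> iter_pd bs \<phi> differentiable (at (x, y))"
proof -
  assume bs: "bs \<in> lists Basis" and x: "x \<in> \<Omega>"
  have "smooth_on W \<phi>" using slow unfolding slowly_increasing_def by simp
  moreover have "(x, y) \<in> W" using x dom by auto
  ultimately show ?thesis using bs unfolding smooth_on_def by simp
qed

lemma slow_bound:
  assumes "compact K" "K \<subseteq> \<Omega>" "bs \<in> lists Basis"
  shows "\<exists>(m::nat) (C::real). 0 \<le> C \<and> (\<forall>x\<in>K. \<forall>y. norm (iter_pd bs \<phi> (x, y)) \<le> C * (1 + norm y) ^ m)"
proof -
  have "K \<subseteq> fst ` W" using assms(2) dom by force
  then have "\<exists>(m::nat) (C::real). \<forall>(x, y)\<in>W. x \<in> K \<longrightarrow> norm (iter_pd bs \<phi> (x, y)) \<le> C * (1 + norm y) ^ m"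
    using slow assms(1,3) unfolding slowly_increasing_def by simp
  then obtain m :: nat and C :: real where
    C: "\<forall>(x, y)\<in>W. x \<in> K \<longrightarrow> norm (iter_pd bs \<phi> (x, y)) \<le> C * (1 + norm y) ^ m"
    by (elim exE) (rule that)
  have *: "norm (iter_pd bs \<phi> (x, y)) \<le> \<bar>C\<bar> * (1 + norm y) ^ m" if "x \<in> K" for x y
  proof -
    have "(x, y) \<in> W" using that assms(2) dom by auto
    with C that have "norm (iter_pd bs \<phi> (x, y)) \<le> C * (1 + norm y) ^ m" by auto
    also have "\<dots> \<le> \<bar>C\<bar> * (1 + norm y) ^ m" by (intro mult_right_mono) auto
    finally show ?thesis .
  qed
  show ?thesis
    by (intro exI[of _ m] exI[of _ "\<bar>C\<bar>"] conjI abs_ge_zero ballI allI *)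
qed

lemma growth_\<phi>:
  assumes "u \<in> moderate_nets \<Omega>" "compact K" "K \<subseteq> \<Omega>" "bs \<in> lists Basis"
  shows "growth_on Moderate K (\<lambda>\<epsilon> x. iter_pd bs \<phi> (x, u \<epsilon> x))"
proof -
  obtain m :: nat and C :: real where
    C: "0 \<le> C" "\<forall>x\<in>K. \<forall>y. norm (iter_pd bs \<phi> (x, y)) \<le> C * (1 + norm y) ^ m"
    using slow_bound[OF assms(2-4)] by (elim exE conjE) (rule that)
  have "growth_on Moderate K (\<lambda>\<epsilon> x. (1 + norm (u \<epsilon> x)) ^ m)"
    using assms(1-3) unfolding moderate_nets_eq
    by (intro growth_on_one_plus_power growth_on_norm) (auto intro: net_class_growth)
  then show ?thesis
    by (rule growth_on_norm_le[where C = C]) (use C in \<open>auto simp: power_abs\<close>)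
qed

text \<open>
  The segment from \<open>(x, y)\<close> to \<open>(x, y')\<close> stays in the fibre over \<open>x\<close>, and on it the norm of the second
  component is at most \<open>norm y + norm y'\<close>. So the bounds \<open>B i\<close> on the partial derivatives are only
  needed there.
\<close>

lemma mean_value_\<phi>:
  assumes "x \<in> \<Omega>" "bs \<in> lists Basis"
    and B: "\<And>i (z::'b). i \<in> Basis \<Longrightarrow> norm z \<le> norm y + norm y' \<Longrightarrow> norm (iter_pd (i # bs) \<phi> (x, z)) \<le> B i"
  shows "norm (iter_pd bs \<phi> (x, y) - iter_pd bs \<phi> (x, y')) \<le> (\<Sum>i\<in>Basis. B i) * norm (y - y')"
proof -
  let ?f = "iter_pd bs \<phi>"
  let ?T = "closed_segment (x, y) (x, y')"
  have T: "\<exists>z. p = (x, z) \<and> norm z \<le> norm y + norm y'" if p: "p \<in> ?T" for p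
  proof -
    from p obtain u where u: "0 \<le> u" "u \<le> 1" "p = (1 - u) *\<^sub>R (x, y) + u *\<^sub>R (x, y')"
      unfolding in_segment by blast
    have "norm ((1 - u) *\<^sub>R y + u *\<^sub>R y') \<le> (1 - u) * norm y + u * norm y'"
      using u by (intro norm_triangle_le) simp
    also have "\<dots> \<le> 1 * norm y + 1 * norm y'"
      using u by (intro add_mono mult_right_mono) auto
    finally have "norm ((1 - u) *\<^sub>R y + u *\<^sub>R y') \<le> norm y + norm y'" by simp
    moreover have "p = (x, (1 - u) *\<^sub>R y + u *\<^sub>R y')"
      unfolding u(3) by (simp add: algebra_simps)
    ultimately show ?thesis by blast
  qed
  have "norm (?f (x, y) - ?f (x, y')) \<le> (\<Sum>i\<in>Basis. B i) * norm ((x, y) - (x, y'))"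
  proof (rule differentiable_bound[OF convex_closed_segment])
    fix p assume "p \<in> ?T"
    then obtain z where z: "p = (x, z)" "norm z \<le> norm y + norm y'" using T by blast
    have "((\<lambda>p. ?f p) has_derivative (\<lambda>h. \<Sum>i\<in>Basis. (h \<bullet> i) *\<^sub>R iter_pd (i # bs) \<phi> p)) (at p)"
      using has_derivative_compose_partials[OF has_derivative_ident differentiable_\<phi>[OF assms(2,1), of z]] z
      by simp
    then show "(?f has_derivative (\<lambda>h. \<Sum>i\<in>Basis. (h \<bullet> i) *\<^sub>R iter_pd (i # bs) \<phi> p)) (at p within ?T)"
      by (simp add: has_derivative_at_withinI)
    show "onorm (\<lambda>h. \<Sum>i\<in>Basis. (h \<bullet> i) *\<^sub>R iter_pd (i # bs) \<phi> p) \<le> (\<Sum>i\<in>Basis. B i)"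
    proof (rule onorm_le)
      fix h :: "'a \<times> 'b"
      have "norm (\<Sum>i\<in>Basis. (h \<bullet> i) *\<^sub>R iter_pd (i # bs) \<phi> p) \<le> (\<Sum>i\<in>Basis. B i * norm h)"
      proof (rule sum_norm_le)
        fix i :: "'a \<times> 'b" assume i: "i \<in> Basis"
        have "norm ((h \<bullet> i) *\<^sub>R iter_pd (i # bs) \<phi> p) \<le> norm h * B i"
          unfolding norm_scaleR z(1) using Basis_le_norm[OF i, of h] B[OF i z(2)]
          by (intro mult_mono) auto
        then show "norm ((h \<bullet> i) *\<^sub>R iter_pd (i # bs) \<phi> p) \<le> B i * norm h"
          by (simp add: mult.commute)
      qed
      then show "norm (\<Sum>i\<in>Basis. (h \<bullet> i) *\<^sub>R iter_pd (i # bs) \<phi> p) \<le> (\<Sum>i\<in>Basis. B i) * norm h"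
        by (simp add: sum_distrib_right)
    qed
  qed auto
  then show ?thesis by (simp add: norm_Pair)
qed

text \<open>
  By the mean value inequality the difference is at most a polynomial in \<open>norm (u\<^sub>\<epsilon>)\<close> and \<open>norm (v\<^sub>\<epsilon>)\<close>, which
  is moderate, times the negligible \<open>norm (u\<^sub>\<epsilon> - v\<^sub>\<epsilon>)\<close>.
\<close>

lemma growth_\<phi>_diff:
  assumes u: "u \<in> moderate_nets \<Omega>" and v: "v \<in> moderate_nets \<Omega>"
    and uv: "(\<lambda>\<epsilon> x. u \<epsilon> x - v \<epsilon> x) \<in> null_nets \<Omega>"
    and K: "compact K" "K \<subseteq> \<Omega>" and bs: "bs \<in> lists Basis"
  shows "growth_on Negligible K (\<lambda>\<epsilon> x. iter_pd bs \<phi> (x, u \<epsilon> x) - iter_pd bs \<phi> (x, v \<epsilon> x))"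
proof -
  have "\<forall>i\<in>Basis. \<exists>m C. 0 \<le> C \<and>
      (\<forall>x\<in>K. \<forall>y. norm (iter_pd (i # bs) \<phi> (x, y)) \<le> C * (1 + norm y) ^ m)"
  proof
    fix i :: "'a \<times> 'b" assume "i \<in> Basis"
    with bs have "i # bs \<in> lists Basis" by simp
    from slow_bound[OF K this] show "\<exists>m C. 0 \<le> C \<and>
      (\<forall>x\<in>K. \<forall>y. norm (iter_pd (i # bs) \<phi> (x, y)) \<le> C * (1 + norm y) ^ m)" .
  qed
  then obtain m C where C: "\<And>i. i \<in> Basis \<Longrightarrow> 0 \<le> C i"
    "\<And>i x y. i \<in> Basis \<Longrightarrow> x \<in> K \<Longrightarrow> norm (iter_pd (i # bs) \<phi> (x, y)) \<le> C i * (1 + norm y) ^ m i"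
    by metis
  define B where "B \<epsilon> x = (\<Sum>i\<in>Basis. C i * (1 + (norm (u \<epsilon> x) + norm (v \<epsilon> x))) ^ m i)" for \<epsilon> x
  have "growth_on Moderate K B"
    unfolding B_def using u v K unfolding moderate_nets_eq
    by (intro growth_on_sum growth_on_const_mult growth_on_one_plus_power growth_on_add growth_on_norm)
      (auto intro: net_class_growth)
  moreover have "growth_on Negligible K (\<lambda>\<epsilon> x. u \<epsilon> x - v \<epsilon> x)"
    using uv K unfolding null_nets_eq by (auto intro: net_class_growth)
  ultimately have "growth_on Negligible K (\<lambda>\<epsilon> x. norm (B \<epsilon> x) * norm (u \<epsilon> x - v \<epsilon> x))"
    by (rule growth_on_mult)
  then show ?thesis
  proof (rule growth_on_norm_le[where C = 1])
    fix \<epsilon> :: real and x assume x: "x \<in> K"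
    have "norm (iter_pd bs \<phi> (x, u \<epsilon> x) - iter_pd bs \<phi> (x, v \<epsilon> x)) \<le> B \<epsilon> x * norm (u \<epsilon> x - v \<epsilon> x)"
      unfolding B_def
    proof (rule mean_value_\<phi>[OF _ bs])
      fix i and z :: 'b assume i: "(i::'a \<times> 'b) \<in> Basis" and z: "norm z \<le> norm (u \<epsilon> x) + norm (v \<epsilon> x)"
      have "norm (iter_pd (i # bs) \<phi> (x, z)) \<le> C i * (1 + norm z) ^ m i"
        by (rule C(2)[OF i x])
      also have "\<dots> \<le> C i * (1 + (norm (u \<epsilon> x) + norm (v \<epsilon> x))) ^ m i"
        using z C(1)[OF i] by (intro mult_left_mono power_mono) auto
      finally show "norm (iter_pd (i # bs) \<phi> (x, z)) \<le> C i * (1 + (norm (u \<epsilon> x) + norm (v \<epsilon> x))) ^ m i" .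
    qed (use x K in auto)
    also have "\<dots> \<le> norm (B \<epsilon> x) * norm (u \<epsilon> x - v \<epsilon> x)"
      by (intro mult_right_mono) auto
    finally show "norm (iter_pd bs \<phi> (x, u \<epsilon> x) - iter_pd bs \<phi> (x, v \<epsilon> x))
        \<le> 1 * norm (norm (B \<epsilon> x) * norm (u \<epsilon> x - v \<epsilon> x))" by simp
  qed
qed

lemma graph_net:
  assumes "u \<in> moderate_nets \<Omega>"
  shows "(\<lambda>\<epsilon> x. (x, u \<epsilon> x)) \<in> net_class Moderate k \<Omega>"
  using assms unfolding moderate_nets_eq
  by (intro net_class_Pair[OF open_\<Omega> net_class_bounded_linear_map[OF open_\<Omega> bounded_linear_ident]]) simp

lemma inv_into_image: "inv_into \<Omega> \<xi> ` \<xi> ` \<Omega> \<subseteq> \<Omega>"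
  by (simp add: image_subset_iff inv_into_into)

lemma act_moderate:
  assumes u: "u \<in> moderate_nets \<Omega>"
  shows "act u \<in> moderate_nets (\<xi> ` \<Omega>)"
proof -
  have "(\<lambda>\<epsilon> x. \<phi> (x, u \<epsilon> x)) \<in> net_class Moderate k \<Omega>" for k
    by (rule net_class_compose[OF open_\<Omega> graph_net[OF u], where F = "\<lambda>\<epsilon>. \<phi>"])
      (auto intro: differentiable_\<phi> growth_\<phi>[OF u])
  from net_class_pullback[OF open_image smooth_inv inv_into_image this]
  show ?thesis
    unfolding moderate_nets_eq act_def comp_def by blast
qed

lemma act_null_diff:
  assumes u: "u \<in> moderate_nets \<Omega>" and v: "v \<in> moderate_nets \<Omega>"
    and uv: "(\<lambda>\<epsilon> x. u \<epsilon> x - v \<epsilon> x) \<in> null_nets \<Omega>"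
  shows "(\<lambda>\<epsilon> x. act u \<epsilon> x - act v \<epsilon> x) \<in> null_nets (\<xi> ` \<Omega>)"
proof -
  have "(\<lambda>\<epsilon> x. \<phi> (x, u \<epsilon> x) - \<phi> (x, v \<epsilon> x)) \<in> net_class Negligible k \<Omega>" for k
  proof (rule net_class_compose_diff[OF open_\<Omega> graph_net[OF u] graph_net[OF v]])
    have "(\<lambda>\<epsilon> x. u \<epsilon> x - v \<epsilon> x) \<in> net_class Negligible k \<Omega>"
      using uv unfolding null_nets_eq by blast
    from net_class_Pair[OF open_\<Omega> net_class_zero[OF open_\<Omega>] this]
    show "(\<lambda>\<epsilon> x. (x, u \<epsilon> x) - (x, v \<epsilon> x)) \<in> net_class Negligible k \<Omega>" by simp
  qed (auto intro: differentiable_\<phi> growth_\<phi>[OF v] growth_\<phi>_diff[OF u v uv])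
  from net_class_pullback[OF open_image smooth_inv inv_into_image this]
  show ?thesis
    unfolding null_nets_eq act_def comp_def by blast
qed

lemma colombeau_act_cl:
  assumes u: "u \<in> moderate_nets \<Omega>"
  shows "colombeau_act \<Omega> \<xi> \<phi> (cl \<Omega> u) = cl (\<xi> ` \<Omega>) (act u)"
proof -
  have "cl (\<xi> ` \<Omega>) (act v) = cl (\<xi> ` \<Omega>) (act u)" if "v \<in> cl \<Omega> u" for v
    using that act_null_diff[OF u, of v] cl_eq_iff[OF open_image act_moderate[OF u] act_moderate[of v]]
    unfolding mem_cl_iff by simp
  then show ?thesis
    unfolding colombeau_act_def act_def[symmetric] using mem_cl[OF open_\<Omega> u] by blast
qed

end

section \<open>The base map of a projectable transformation\<close>

lemma open_group_dom:
  assumes "open V" shows "open (group_dom V \<eta>)"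
proof -
  have "group_dom V \<eta> = (\<lambda>z. (\<eta>, z)) -` V" unfolding group_dom_def by auto
  then show ?thesis by (simp add: open_vimage[OF assms] continuous_on_Pair)
qed

text \<open>
  The inverse of \<open>g \<eta>\<close> is \<open>g (- \<eta>)\<close>, which is projectable too. Its base map \<open>\<Xi> (- \<eta>)\<close> inverts \<open>\<Xi> \<eta>\<close> on \<open>\<Omega>\<close>,
  and near a point of the image it is the first component of \<open>g (- \<eta>)\<close> along a fixed \<open>w\<close>, hence smooth.
  The image of \<open>\<Omega>\<close> is open, being the projection of the open set of all \<open>z\<close> that \<open>g (- \<eta>)\<close> maps
  into \<open>\<Omega> \<times> UNIV\<close>.
\<close>

lemma projected_transformation:
  fixes g :: "real \<Rightarrow> ('a::euclidean_space \<times> 'b::euclidean_space) \<Rightarrow> ('a \<times> 'b)"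
  assumes G: "local_transformation_group M V g"
    and act: "slowly_increasing_action V g \<Xi> \<Phi>"
    and \<Omega>: "open \<Omega>" and dom: "\<Omega> \<times> UNIV \<subseteq> group_dom V \<eta>"
  shows "inj_on (\<Xi> \<eta>) \<Omega>" "open (\<Xi> \<eta> ` \<Omega>)" "smooth_on (\<Xi> \<eta> ` \<Omega>) (inv_into \<Omega> (\<Xi> \<eta>))"
    "\<And>x. x \<in> \<Omega> \<Longrightarrow> \<Xi> \<eta> x \<in> fst ` M"
proof -
  have V: "open V" and gM: "\<And>\<theta> z. (\<theta>, z) \<in> V \<Longrightarrow> g \<theta> z \<in> M"
    and smooth: "smooth_on V (\<lambda>(\<theta>, z). g \<theta> z)"
    and inverse: "\<And>\<theta> z. (\<theta>, z) \<in> V \<Longrightarrow> (- \<theta>, g \<theta> z) \<in> V \<and> g (- \<theta>) (g \<theta> z) = z"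
    using G unfolding local_transformation_group_def by blast+
  have proj: "g \<theta> (x, y) = (\<Xi> \<theta> x, \<Phi> \<theta> (x, y))" if "(\<theta>, x, y) \<in> V" for \<theta> x y
    using act that unfolding slowly_increasing_action_def group_dom_def by blast
  have in_V: "(\<eta>, x, y) \<in> V" if "x \<in> \<Omega>" for x y
    using dom that unfolding group_dom_def by blast
  have in_V': "(- \<eta>, \<Xi> \<eta> x, \<Phi> \<eta> (x, y)) \<in> V" if "x \<in> \<Omega>" for x y
    using inverse[OF in_V[OF that]] proj[OF in_V[OF that]] by metis
  have left_inverse: "\<Xi> (- \<eta>) (\<Xi> \<eta> x) = x" if "x \<in> \<Omega>" for x
    using inverse[OF in_V[OF that]] proj[OF in_V[OF that]] proj[OF in_V'[OF that]]
    by (metis fst_conv)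
  show inj: "inj_on (\<Xi> \<eta>) \<Omega>"
    by (rule inj_on_inverseI[where g = "\<Xi> (- \<eta>)"]) (rule left_inverse)
  have inv: "inv_into \<Omega> (\<Xi> \<eta>) y = \<Xi> (- \<eta>) y" if "y \<in> \<Xi> \<eta> ` \<Omega>" for y
    using that inj left_inverse by (auto simp: inv_into_f_f)
  show "\<Xi> \<eta> x \<in> fst ` M" if "x \<in> \<Omega>" for x
    using gM[OF in_V[OF that, of 0]] proj[OF in_V[OF that, of 0]] by force
  show open_image: "open (\<Xi> \<eta> ` \<Omega>)"
  proof -
    let ?W = "group_dom V (- \<eta>)"
    let ?T = "?W \<inter> g (- \<eta>) -` (\<Omega> \<times> UNIV)"
    have "continuous_on ?W (\<lambda>z. (\<lambda>(\<theta>, z). g \<theta> z) (- \<eta>, z))"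
      by (rule continuous_on_compose2[OF smooth_on_imp_continuous_on[OF smooth]])
        (auto intro!: continuous_intros simp: group_dom_def)
    then have "open ?T"
      by (intro continuous_open_preimage open_group_dom[OF V] open_Times \<Omega>) auto
    moreover have "\<Xi> \<eta> ` \<Omega> = fst ` ?T"
    proof (intro equalityI subsetI)
      fix y assume "y \<in> \<Xi> \<eta> ` \<Omega>"
      then obtain x where x: "x \<in> \<Omega>" "y = \<Xi> \<eta> x" by blast
      have "g \<eta> (x, 0) \<in> ?T"
        using inverse[OF in_V[OF x(1), of 0]] x(1) by (simp add: group_dom_def)
      then show "y \<in> fst ` ?T"
        using proj[OF in_V[OF x(1), of 0]] x(2) by (metis fst_conv imageI)
    next
      fix y assume "y \<in> fst ` ?T"
      then obtain z where z: "y = fst z" "(- \<eta>, z) \<in> V" "g (- \<eta>) z \<in> \<Omega> \<times> UNIV"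
        by (auto simp: group_dom_def)
      obtain x w where xw: "g (- \<eta>) z = (x, w)" "x \<in> \<Omega>" using z(3) by auto
      have "g \<eta> (x, w) = z" using inverse[OF z(2)] xw by simp
      then show "y \<in> \<Xi> \<eta> ` \<Omega>" using proj[OF in_V[OF xw(2), of w]] z(1) xw(2) by force
    qed
    ultimately show ?thesis using open_image_fst by metis
  qed
  show "smooth_on (\<Xi> \<eta> ` \<Omega>) (inv_into \<Omega> (\<Xi> \<eta>))"
    unfolding smooth_on_def
  proof (intro ballI)
    fix bs :: "'a list" and y assume bs: "bs \<in> lists Basis" and y: "y \<in> \<Xi> \<eta> ` \<Omega>"
    then obtain x where x: "x \<in> \<Omega>" "y = \<Xi> \<eta> x" by blast
    define w where "w = \<Phi> \<eta> (x, 0)"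
    define N where "N = \<Xi> \<eta> ` \<Omega> \<inter> (\<lambda>y. (- \<eta>, y, w)) -` V"
    have N: "open N"
      unfolding N_def by (intro open_Int open_image open_vimage[OF V] continuous_intros)
    have "smooth_on N (\<lambda>y. (- \<eta>, y, w))"
      by (intro smooth_on_Pair[OF N] smooth_on_const[OF N] smooth_on_linear[OF N bounded_linear_ident])
    then have "smooth_on N (\<lambda>y. (\<lambda>(\<theta>, z). g \<theta> z) (- \<eta>, y, w))"
      by (rule smooth_on_compose[OF N _ _ smooth]) (auto simp: N_def)
    then have "smooth_on N (\<lambda>y. fst ((\<lambda>(\<theta>, z). g \<theta> z) (- \<eta>, y, w)))"
      by (intro smooth_on_compose[OF N _ _ smooth_on_linear[OF open_UNIV bounded_linear_fst]]) auto
    also have "?this \<longleftrightarrow> smooth_on N (inv_into \<Omega> (\<Xi> \<eta>))"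
      by (rule smooth_on_cong[OF N]) (auto simp: N_def inv[OF imageI] proj)
    finally have "smooth_on N (inv_into \<Omega> (\<Xi> \<eta>))" .
    moreover have "y \<in> N"
      using y in_V'[OF x(1), of 0] x(2) by (simp add: N_def w_def)
    ultimately show "iter_pd bs (inv_into \<Omega> (\<Xi> \<eta>)) differentiable (at y)"
      using bs unfolding smooth_on_def by blast
  qed
qed

section \<open>Symmetry groups of surjective linear systems\<close>

theorem theorem3p11:
  fixes X \<Omega> :: "(real^'p::finite) set"
    and c :: "'k::finite \<Rightarrow> 'l::finite \<times> 'p list"
    and n :: nat
    and \<Delta> :: "(real^'p) \<times> (real^'k) \<Rightarrow> real^'l"
    and M :: "((real^'p) \<times> (real^'l)) set"
    and V :: "(real \<times> (real^'p) \<times> (real^'l)) set"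
    and g :: "real \<Rightarrow> (real^'p) \<times> (real^'l) \<Rightarrow> (real^'p) \<times> (real^'l)"
    and \<Xi> :: "real \<Rightarrow> real^'p \<Rightarrow> real^'p"
    and \<Phi> :: "real \<Rightarrow> (real^'p) \<times> (real^'l) \<Rightarrow> real^'l"
  assumes "open X" and "open \<Omega>" and "\<Omega> \<subseteq> X"
    and "jet_coords n c"
    and "slowly_increasing (X \<times> UNIV) \<Delta>"
    and "\<forall>x\<in>X. linear (\<lambda>w. \<Delta> (x, w))"
    and "\<forall>f. smooth_on \<Omega> f \<longrightarrow> (\<exists>u. smooth_on \<Omega> u \<and> (\<forall>x\<in>\<Omega>. diff_op c \<Delta> u x = f x))"
    and "local_transformation_group M V g"
    and "M \<subseteq> X \<times> UNIV"
    and "slowly_increasing_action V g \<Xi> \<Phi>"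
    and "classical_symmetry_group \<Omega> c \<Delta> V g"
  shows "colombeau_symmetry_group \<Omega> c \<Delta> V \<Xi> \<Phi>"
  unfolding colombeau_symmetry_group_def
proof (intro allI impI)
  fix \<eta> U
  assume U: "colombeau_solution \<Omega> c \<Delta> U" and dom: "\<Omega> \<times> UNIV \<subseteq> group_dom V \<eta>"
  have linear_op: "linear_diff_op \<Delta> S" if "open S" "S \<subseteq> X" for S
  proof (rule linear_diff_op.intro)
    show "smooth_on (S \<times> UNIV) \<Delta>"
      using assms(5) that(2) smooth_on_subset[of "X \<times> UNIV" \<Delta> "S \<times> UNIV"]
      unfolding slowly_increasing_def by blast
    show "linear (\<lambda>w. \<Delta> (x, w))" if "x \<in> S" for x
      using assms(6) \<open>S \<subseteq> X\<close> that by blast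
  qed fact
  note proj = projected_transformation[OF assms(8,10,2) dom]
  have image_X: "\<Xi> \<eta> ` \<Omega> \<subseteq> X"
    using proj(4) assms(9) by force
  interpret source: linear_diff_op c \<Delta> \<Omega>
    by (rule linear_op) fact+
  interpret target: linear_diff_op c \<Delta> "\<Xi> \<eta> ` \<Omega>"
    by (rule linear_op[OF proj(2) image_X])
  interpret slow_transformation \<Omega> "group_dom V \<eta>" "\<Xi> \<eta>" "\<Phi> \<eta>"
    using assms(2,10) proj dom unfolding slowly_increasing_action_def by unfold_locales auto
  obtain K where "exhaustion \<Omega> K"
    using exhaustion_exists[OF assms(2)] by blast
  then interpret surjective_operator \<Omega> K "diff_op c \<Delta>"
    unfolding surjective_operator_def surjective_operator_axioms_def
    using source.diff_op_smooth source.diff_op_lincomb source.diff_op_null assms(7) by blast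
  obtain u where u: "u \<in> moderate_nets \<Omega>" "U = cl \<Omega> u"
  proof -
    have "U \<in> colombeau \<Omega>" using U unfolding colombeau_solution_def by blast
    then show ?thesis
      unfolding colombeau_def cl_def by (rule quotientE) (rule that, auto simp: cl_def)
  qed
  then have "(\<lambda>\<epsilon>. diff_op c \<Delta> (u \<epsilon>)) \<in> null_nets \<Omega>"
    using U source.colombeau_solution_cl_iff by blast
  \<comment> \<open>The correction that turns the representative \<open>u\<close> into a net of exact solutions.\<close>
  then obtain v where v: "v \<in> null_nets \<Omega>"
    "\<And>\<epsilon> x. \<epsilon> \<in> {0<..1} \<Longrightarrow> x \<in> \<Omega> \<Longrightarrow> diff_op c \<Delta> (v \<epsilon>) x = diff_op c \<Delta> (u \<epsilon>) x"
    using null_net_lifting by blast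
  define w where "w = (\<lambda>\<epsilon> x. u \<epsilon> x - v \<epsilon> x)"
  have w: "w \<in> moderate_nets \<Omega>"
    unfolding w_def using null_nets_subset_moderate_nets[OF v(1)] u(1)
    by (intro moderate_nets_diff assms(2))
  have "U = cl \<Omega> w"
    unfolding u(2) cl_eq_iff[OF assms(2) u(1) w] using v(1) by (simp add: w_def)
  have solution: "smooth_solution \<Omega> c \<Delta> (w \<epsilon>)" if \<epsilon>: "\<epsilon> \<in> {0<..1}" for \<epsilon>
    using moderate_nets_smooth[OF w \<epsilon>] v(2)[OF \<epsilon>]
      P_diff[OF moderate_nets_smooth[OF u(1) \<epsilon>] null_nets_smooth[OF v(1) \<epsilon>]]
    unfolding smooth_solution_def w_def by simp
  have "smooth_solution (\<Xi> \<eta> ` \<Omega>) c \<Delta> (act w \<epsilon>)" if \<epsilon>: "\<epsilon> \<in> {0<..1}" for \<epsilon>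
  proof -
    have graph: "graph_over \<Omega> (w \<epsilon>) \<subseteq> group_dom V \<eta>"
      using dom unfolding graph_over_def by blast
    have "g \<eta> (x, w \<epsilon> x) = (\<Xi> \<eta> x, act w \<epsilon> (\<Xi> \<eta> x))" if x: "x \<in> \<Omega>" for x
    proof -
      have "(x, w \<epsilon> x) \<in> group_dom V \<eta>"
        using dom x by blast
      then have "g \<eta> (x, w \<epsilon> x) = (\<Xi> \<eta> x, \<Phi> \<eta> (x, w \<epsilon> x))"
        using assms(10) unfolding slowly_increasing_action_def by blast
      then show ?thesis
        using inv_into_f_f[OF proj(1) x] by (simp add: act_def)
    qed
    then have "g \<eta> ` graph_over \<Omega> (w \<epsilon>) = graph_over (\<Xi> \<eta> ` \<Omega>) (act w \<epsilon>)"
      unfolding graph_over_def image_image by (rule image_cong[OF refl])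
    with assms(11) solution[OF \<epsilon>] graph show ?thesis
      unfolding classical_symmetry_group_def by blast
  qed
  then have "(\<lambda>\<epsilon>. diff_op c \<Delta> (act w \<epsilon>)) \<in> null_nets (\<Xi> \<eta> ` \<Omega>)"
    using zero_null_net[OF proj(2)]
    by (subst null_nets_cong[OF proj(2), of _ "\<lambda>\<epsilon> x. 0"]) (auto simp: smooth_solution_def)
  then show "colombeau_solution (\<Xi> \<eta> ` \<Omega>) c \<Delta> (colombeau_act \<Omega> (\<Xi> \<eta>) (\<Phi> \<eta>) U)"
    unfolding \<open>U = cl \<Omega> w\<close> colombeau_act_cl[OF w] target.colombeau_solution_cl_iff[OF act_moderate[OF w]] .
qed

end
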